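(* Let $E\subset\mathbb{R}$ be a Borel set, and fix $x\in\mathbb{R}$. Then the following are equivalent: (a) $\mu(\{x\})=0$ for all $\mu\in\mathcal{R}(E)$. (b) $$\int_{x-1}^{x+1} \frac{\chi_E(t)}{|t-x|}\, dt = \infty .$$
   Context: A Herglotz function is a holomorphic mapping $F$ of $\mathbb{C}^+=\{z\in\mathbb{C}:\operatorname{Im} z>0\}$ to itself; for such $F$ the limit $F(t)=\lim_{y\to0+}F(t+iy)$ exists for Lebesgue almost every $t\in\mathbb{R}$. $\mathcal{N}(E)$ is the set of Herglotz functions that are reflectionless on $E$, i.e. $\operatorname{Re}F(t)=0$ for almost every $t\in E$. Every Herglotz function has a unique representation $$F(z)=F_\mu(z)=a+bz+\int_{-\infty}^\infty\left(\frac1{t-z}-\frac{t}{t^2+1}\right)d\mu(t),$$ with $a\in\mathbb{R}$, $b\ge0$ and a positive Borel measure $\mu$ on $\mathbb{R}$ with $\int_{\mathbb{R}}\frac{d\mu(t)}{t^2+1}<\infty$. $\mathcal{R}(E)$ is the set of all such measures $\mu$ for which $F_\mu\in\mathcal{N}(E)$ for some choice of $a\in\mathbb{R}$, $b\ge0$. $\chi_E$ is the indicator function of $E$. *)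

theory Defs
  imports "HOL-Complex_Analysis.Complex_Analysis"
begin

definition upper_half_plane :: "complex set" where
  "upper_half_plane = {z. Im z > 0}"

definition Herglotz :: "(complex \<Rightarrow> complex) \<Rightarrow> bool" where
  "Herglotz F \<longleftrightarrow> F holomorphic_on upper_half_plane \<and> F ` upper_half_plane \<subseteq> upper_half_plane"

(* The boundary value F(t) is the vertical limit of F(t + iy) as y tends to 0 from above.
   Its existence (which holds almost everywhere for every Herglotz function) is part of the
   almost-everywhere condition, so no default value of a limit operator is involved. *)
definition reflectionless_class :: "real set \<Rightarrow> (complex \<Rightarrow> complex) set" where
  "reflectionless_class E = {F. Herglotz F \<and>
     (AE t in lborel. t \<in> E \<longrightarrow>
        (\<exists>w. ((\<lambda>y. F (of_real t + \<i> * of_real y)) \<longlongrightarrow> w) (at_right 0) \<and> Re w = 0))}"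

definition Herglotz_fun :: "real \<Rightarrow> real \<Rightarrow> real measure \<Rightarrow> complex \<Rightarrow> complex" where
  "Herglotz_fun a b \<mu> z = of_real a + of_real b * z +
     (LINT t|\<mu>. 1 / (of_real t - z) - of_real t / (of_real t ^ 2 + 1))"

definition Herglotz_measure :: "real measure \<Rightarrow> bool" where
  "Herglotz_measure \<mu> \<longleftrightarrow> sets \<mu> = sets borel \<and>
     (\<integral>\<^sup>+ t. ennreal (1 / (t ^ 2 + 1)) \<partial>\<mu>) < \<infinity>"

definition reflectionless_measures :: "real set \<Rightarrow> real measure set" where
  "reflectionless_measures E = {\<mu>. Herglotz_measure \<mu> \<and>
     (\<exists>a b. b \<ge> 0 \<and> Herglotz_fun a b \<mu> \<in> reflectionless_class E)}"

end

theory Submission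
  imports Defs "HOL-Probability.Helly_Selection"
begin

text \<open>
  A point mass of \<open>\<mu>\<close> at \<open>x\<close> means that \<open>F = F\<^sub>\<mu>\<close> grows like \<open>1 / y\<close> at \<open>x + \<i>y\<close>, and this growth
  can be read off from the argument of \<open>F\<close> on the real line. Among all functions with
  \<open>0 \<le> arg F \<le> \<pi>\<close>, the growth \<open>1 / y\<close> is the fastest possible, and it is attained when the argument is
  \<open>0\<close> to the left of \<open>x\<close> and \<open>\<pi>\<close> to the right, as for \<open>1 / (x - z)\<close>. Every deviation
  from this profile costs its integral against \<open>dt / \<bar>t - x\<bar>\<close> in \<open>log \<bar>F\<bar>\<close>. A function that is
  reflectionless on \<open>E\<close> has argument \<open>\<pi> / 2\<close> on \<open>E\<close>, hence deviates there by \<open>\<pi> / 2\<close>. So an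
  atom at \<open>x\<close> is possible exactly if \<open>\<integral>\<^sub>E dt / \<bar>t - x\<bar>\<close> converges near \<open>x\<close>.

  An atom forces convergence: integrating \<open>log F (z) / (z - x)\<close> over the boundary of a half annulus
  expresses the integral of the deviation through the means of \<open>log \<bar>F\<bar>\<close> over two half circles
  (lemma \<open>half_annulus_integral\<close>). The atom bounds the inner mean from below and the growth of
  Herglotz functions bounds the outer mean from above, so that the integral of the deviation stays
  bounded as the inner radius tends to zero (lemma \<open>argument_deficiency_bound\<close>). The contour
  has to stay in the open half plane; it is shifted up by a small amount, and Fatou's lemma
  transfers the bound to the boundary values.

  Convergence permits an atom: the function with argument \<open>\<pi> / 2\<close> on \<open>E\<close> and with the extremal
  argument elsewhere near \<open>x\<close> is \<open>\<i> exp (h (z))\<close>, where \<open>h\<close> is the Cauchy transform of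
  \<open>sgn (t - x) / 2\<close> on a set \<open>K\<close>. If \<open>E\<close> is first enlarged to an open set, without losing
  convergence (lemma \<open>open_cover_finite_integral\<close>), then \<open>K\<close> is closed, and \<open>h\<close>
  extends continuously to \<open>E\<close> with real values. The measure itself comes from the Herglotz
  representation theorem, proved here from the Schwarz integral formula on the disc and Helly's selection
  theorem (theorem \<open>Herglotz_representation\<close>). It must charge \<open>x\<close>, because otherwise \<open>y F (x + \<i>y)\<close>
  would tend to zero by dominated convergence (lemma \<open>Herglotz_fun_atom_limit\<close>).
\<close>

section \<open>Herglotz functions of measures\<close>

text \<open>
  In this form the kernel is \<open>1 / (t\<^sup>2 + 1)\<close> times a bounded function of \<open>t\<close>, so that integrability and all
  growth estimates reduce to the weight \<open>1 / (t\<^sup>2 + 1)\<close>.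
\<close>
lemma Herglotz_kernel_eq:
  assumes "Im z > 0"
  shows "1 / (complex_of_real t - z) - of_real t / (of_real t ^ 2 + 1) =
    (z + (1 + z\<^sup>2) / (of_real t - z)) / of_real (t\<^sup>2 + 1)"
proof -
  have "complex_of_real t - z \<noteq> 0" using assms by (auto simp: complex_eq_iff)
  moreover have "(of_real t)\<^sup>2 + 1 \<noteq> (0 :: complex)"
    using add_pos_nonneg[of 1 "t\<^sup>2"] by (simp add: complex_eq_iff power2_eq_square)
  ultimately show ?thesis by (simp add: field_simps power2_eq_square)
qed

lemma Im_le_cmod_diff: "Im z \<le> cmod (complex_of_real t - z)"
  using abs_Im_le_cmod[of "complex_of_real t - z"] by simp

lemma Herglotz_kernel_bound:
  assumes "Im z > 0"
  shows "cmod (1 / (complex_of_real t - z) - of_real t / (of_real t ^ 2 + 1)) \<le>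
    (cmod z + (1 + (cmod z)\<^sup>2) / Im z) * (1 / (t\<^sup>2 + 1))"
proof -
  have "cmod (z + (1 + z\<^sup>2) / (of_real t - z)) \<le> cmod z + cmod (1 + z\<^sup>2) / cmod (of_real t - z)"
    using norm_triangle_ineq[of z "(1 + z\<^sup>2) / (of_real t - z)"] by (simp add: norm_divide)
  also have "\<dots> \<le> cmod z + (1 + (cmod z)\<^sup>2) / Im z"
    using assms Im_le_cmod_diff[of z t] norm_triangle_ineq[of 1 "z\<^sup>2"]
    by (intro add_left_mono frac_le) (auto simp: norm_power)
  finally show ?thesis
    unfolding Herglotz_kernel_eq[OF assms] norm_divide norm_of_real
    by (simp add: divide_right_mono)
qed

lemma Herglotz_measure_sets: "Herglotz_measure \<mu> \<Longrightarrow> sets \<mu> = sets borel"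
  by (simp add: Herglotz_measure_def)

lemma Herglotz_measure_integrable_weight:
  assumes "Herglotz_measure \<mu>"
  shows "integrable \<mu> (\<lambda>t. 1 / (t\<^sup>2 + 1))"
proof -
  note [measurable_cong] = Herglotz_measure_sets[OF assms]
  have "(\<lambda>t. 1 / (t\<^sup>2 + 1)) \<in> borel_measurable \<mu>" by measurable
  then show ?thesis
    using assms by (intro integrableI_nonneg) (auto simp: Herglotz_measure_def)
qed

lemma Herglotz_kernel_integrable:
  assumes \<mu>: "Herglotz_measure \<mu>" and z: "Im z > 0"
  shows "integrable \<mu> (\<lambda>t. 1 / (complex_of_real t - z) - of_real t / (of_real t ^ 2 + 1))"
proof -
  note [measurable_cong] = Herglotz_measure_sets[OF \<mu>]
  have "integrable \<mu> (\<lambda>t. (cmod z + (1 + (cmod z)\<^sup>2) / Im z) * (1 / (t\<^sup>2 + 1)))"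
    by (intro integrable_mult_right Herglotz_measure_integrable_weight[OF \<mu>])
  then show ?thesis
    by (rule Bochner_Integration.integrable_bound)
      (use Herglotz_kernel_bound[OF z] z in \<open>auto intro!: AE_I2 order_trans[OF _ abs_ge_self]\<close>)
qed

lemma Herglotz_measure_atom_finite:
  assumes \<mu>: "Herglotz_measure \<mu>"
  shows "emeasure \<mu> {x} < \<infinity>"
proof -
  note [measurable_cong] = Herglotz_measure_sets[OF \<mu>]
  have "emeasure \<mu> {x} = (\<integral>\<^sup>+ t. indicator {x} t \<partial>\<mu>)" by simp
  also have "\<dots> \<le> (\<integral>\<^sup>+ t. ennreal (x\<^sup>2 + 1) * ennreal (1 / (t\<^sup>2 + 1)) \<partial>\<mu>)"
  proof (intro nn_integral_mono)
    have "x\<^sup>2 + 1 \<noteq> 0" using add_pos_nonneg[of 1 "x\<^sup>2"] by auto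
    then have "ennreal (x\<^sup>2 + 1) * ennreal (1 / (x\<^sup>2 + 1)) = 1"
      by (subst ennreal_mult[symmetric]) auto
    then show "indicator {x} t \<le> ennreal (x\<^sup>2 + 1) * ennreal (1 / (t\<^sup>2 + 1))" for t
      by (simp split: split_indicator)
  qed
  also have "\<dots> = ennreal (x\<^sup>2 + 1) * (\<integral>\<^sup>+ t. ennreal (1 / (t\<^sup>2 + 1)) \<partial>\<mu>)"
    by (intro nn_integral_cmult) auto
  also have "\<dots> < \<infinity>"
    using \<mu> by (auto simp: Herglotz_measure_def ennreal_mult_less_top)
  finally show ?thesis .
qed

text \<open>
  The imaginary part of \<open>F\<^sub>\<mu>\<close> is \<open>b Im z\<close> plus the Poisson integral of \<open>\<mu>\<close>, and the atom alone contributes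
  the left-hand side.
\<close>
lemma Herglotz_fun_Im_ge:
  assumes \<mu>: "Herglotz_measure \<mu>" and b: "b \<ge> 0" and z: "Im z > 0"
  shows "measure \<mu> {x} * Im z / (cmod (z - of_real x))\<^sup>2 \<le> Im (Herglotz_fun a b \<mu> z)"
proof -
  note [measurable_cong] = Herglotz_measure_sets[OF \<mu>]
  note int = Herglotz_kernel_integrable[OF \<mu> z]
  have Im_kernel: "Im (1 / (complex_of_real t - z) - of_real t / (of_real t ^ 2 + 1)) =
    Im z / (cmod (of_real t - z))\<^sup>2" for t
  proof -
    have "of_real t / (of_real t ^ 2 + 1) = complex_of_real (t / (t\<^sup>2 + 1))" by simp
    then show ?thesis by (simp add: Im_divide cmod_def del: of_real_divide)
  qed
  have "measure \<mu> {x} * Im z / (cmod (z - of_real x))\<^sup>2 =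
      (LINT t|\<mu>. indicator {x} t * (Im z / (cmod (z - of_real x))\<^sup>2))"
    using Herglotz_measure_sets[OF \<mu>] sets_eq_imp_space_eq[OF Herglotz_measure_sets[OF \<mu>]] by simp
  also have "\<dots> \<le> (LINT t|\<mu>. Im (1 / (complex_of_real t - z) - of_real t / (of_real t ^ 2 + 1)))"
  proof (rule integral_mono)
    show "integrable \<mu> (\<lambda>t. indicator {x} t * (Im z / (cmod (z - of_real x))\<^sup>2))"
      using Herglotz_measure_atom_finite[OF \<mu>] by (intro integrable_mult_left integrable_real_indicator) auto
    show "integrable \<mu> (\<lambda>t. Im (1 / (complex_of_real t - z) - of_real t / (of_real t ^ 2 + 1)))"
      by (intro integrable_Im int)
    show "indicator {x} t * (Im z / (cmod (z - of_real x))\<^sup>2)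
        \<le> Im (1 / (complex_of_real t - z) - of_real t / (of_real t ^ 2 + 1))" for t
      unfolding Im_kernel using z by (auto simp: norm_minus_commute split: split_indicator)
  qed
  also have "\<dots> = Im (LINT t|\<mu>. 1 / (complex_of_real t - z) - of_real t / (of_real t ^ 2 + 1))"
    using integral_Im[OF int] by simp
  also have "\<dots> \<le> Im (Herglotz_fun a b \<mu> z)" using b z by (simp add: Herglotz_fun_def)
  finally show ?thesis .
qed

text \<open>
  The growth estimate is stated for \<open>F\<^sub>\<mu> + \<i>\<close>, because it is this function whose
  logarithm is integrated later.
\<close>
lemma Herglotz_fun_upper_bound:
  assumes \<mu>: "Herglotz_measure \<mu>" and b: "b \<ge> 0"
  obtains C where "C > 0" "\<And>z. Im z > 0 \<Longrightarrow> cmod (z - of_real x) \<le> 2 \<Longrightarrow> cmod (Herglotz_fun a b \<mu> z + \<i>) \<le> C / Im z"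
proof -
  define N where "N = (LINT t|\<mu>. 1 / (t\<^sup>2 + 1))"
  define R where "R = \<bar>x\<bar> + 2"
  have N: "N \<ge> 0" unfolding N_def by (intro integral_nonneg_AE) auto
  have R: "R > 0" by (simp add: R_def)
  define C where "C = 2 * (\<bar>a\<bar> + b * R + N * R + 1) + N * (1 + R\<^sup>2)"
  have "cmod (Herglotz_fun a b \<mu> z + \<i>) \<le> C / Im z" if z: "Im z > 0" "cmod (z - of_real x) \<le> 2" for z
  proof -
    have zR: "cmod z \<le> R" using norm_triangle_ineq2[of z "of_real x"] z by (simp add: R_def)
    have Im: "1 \<le> 2 / Im z" using abs_Im_le_cmod[of "z - of_real x"] z by simp
    have "cmod (LINT t|\<mu>. 1 / (of_real t - z) - of_real t / (of_real t ^ 2 + 1)) \<le>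
        (LINT t|\<mu>. (cmod z + (1 + (cmod z)\<^sup>2) / Im z) * (1 / (t\<^sup>2 + 1)))"
      by (rule Bochner_Integration.integral_norm_bound_integral[OF Herglotz_kernel_integrable[OF \<mu> z(1)]
            integrable_mult_right[OF Herglotz_measure_integrable_weight[OF \<mu>]] Herglotz_kernel_bound[OF z(1)]])
    also have "\<dots> = N * (cmod z + (1 + (cmod z)\<^sup>2) / Im z)"
      unfolding N_def by (subst integral_mult_right_zero) (rule mult.commute)
    also have "\<dots> \<le> N * (R + (1 + R\<^sup>2) / Im z)"
      using N zR z by (intro mult_left_mono add_mono divide_right_mono power_mono) auto
    finally have K: "cmod (LINT t|\<mu>. 1 / (of_real t - z) - of_real t / (of_real t ^ 2 + 1)) \<le> N * (R + (1 + R\<^sup>2) / Im z)" .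
    have "cmod (Herglotz_fun a b \<mu> z + \<i>) \<le> \<bar>a\<bar> + b * R + N * (R + (1 + R\<^sup>2) / Im z) + 1"
      unfolding Herglotz_fun_def using b zR
      by (intro norm_triangle_mono K) (auto simp: norm_mult mult_left_mono)
    also have "\<dots> = (\<bar>a\<bar> + b * R + N * R + 1) * 1 + N * (1 + R\<^sup>2) / Im z" by (simp add: algebra_simps)
    also have "\<dots> \<le> (\<bar>a\<bar> + b * R + N * R + 1) * (2 / Im z) + N * (1 + R\<^sup>2) / Im z"
      using b R N Im by (intro add_right_mono mult_left_mono) auto
    also have "\<dots> = C / Im z" using z by (simp add: C_def field_simps)
    finally show ?thesis .
  qed
  moreover have "C > 0"
    unfolding C_def using b R N
    by (intro add_pos_nonneg mult_pos_pos mult_nonneg_nonneg add_nonneg_pos add_nonneg_nonneg) auto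
  ultimately show ?thesis using that by blast
qed

text \<open>
  The factor \<open>y\<close> compensates the singularity \<open>1 / Im z\<close> in the bound for the kernel, which gives an integrable
  majorant, while the integrand tends to zero at every \<open>t \<noteq> x\<close>.
\<close>
lemma Herglotz_fun_atom_limit:
  assumes \<mu>: "Herglotz_measure \<mu>" and x: "emeasure \<mu> {x} = 0"
    and y: "\<And>n. y n > 0" "\<And>n. y n \<le> 1" "y \<longlonglongrightarrow> 0"
  shows "(\<lambda>n. of_real (y n) * Herglotz_fun a b \<mu> (of_real x + \<i> * of_real (y n))) \<longlonglongrightarrow> 0"
proof -
  note [measurable_cong] = Herglotz_measure_sets[OF \<mu>]
  define z where "z n = of_real x + \<i> * complex_of_real (y n)" for n
  define k where "k n t = 1 / (complex_of_real t - z n) - of_real t / (of_real t ^ 2 + 1)" for n t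
  define R where "R = \<bar>x\<bar> + 1"
  have Imz: "Im (z n) = y n" for n by (simp add: z_def)
  have zlim: "z \<longlonglongrightarrow> of_real x" unfolding z_def by (auto intro!: tendsto_eq_intros y)
  have zR: "cmod (z n) \<le> R" for n
    using norm_triangle_ineq[of "of_real x" "\<i> * complex_of_real (y n)"] y(1)[of n] y(2)[of n] by (simp add: z_def R_def norm_mult)
  have "(\<lambda>n. LINT t|\<mu>. of_real (y n) * k n t) \<longlonglongrightarrow> (LINT t|\<mu>. (0 :: complex))"
  proof (rule integral_dominated_convergence)
    show "integrable \<mu> (\<lambda>t. (R + (1 + R\<^sup>2)) * (1 / (t\<^sup>2 + 1)))"
      by (rule integrable_mult_right[OF Herglotz_measure_integrable_weight[OF \<mu>]])
    have "cmod (of_real (y n) * k n t) \<le> (R + (1 + R\<^sup>2)) * (1 / (t\<^sup>2 + 1))" for n t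
    proof -
      have "cmod (of_real (y n) * k n t) \<le> y n * ((cmod (z n) + (1 + (cmod (z n))\<^sup>2) / y n) * (1 / (t\<^sup>2 + 1)))"
        using Herglotz_kernel_bound[of "z n" t] y(1)[of n] by (simp add: norm_mult k_def Imz del: times_divide_eq_right)
      also have "\<dots> = (y n * cmod (z n) + y n * ((1 + (cmod (z n))\<^sup>2) / y n)) * (1 / (t\<^sup>2 + 1))"
        by (simp only: distrib_left mult.assoc[symmetric])
      also have "y n * ((1 + (cmod (z n))\<^sup>2) / y n) = 1 + (cmod (z n))\<^sup>2"
        using y(1)[of n] by simp
      also have "(y n * cmod (z n) + (1 + (cmod (z n))\<^sup>2)) * (1 / (t\<^sup>2 + 1)) \<le> (1 * R + (1 + R\<^sup>2)) * (1 / (t\<^sup>2 + 1))"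
        using y(1)[of n] y(2)[of n] zR[of n] by (intro mult_right_mono add_mono mult_mono power_mono) auto
      finally show ?thesis by simp
    qed
    then show "AE t in \<mu>. norm (of_real (y n) * k n t) \<le> (R + (1 + R\<^sup>2)) * (1 / (t\<^sup>2 + 1))" for n by simp
    \<comment> \<open>The integrand does not tend to zero at \<open>t = x\<close>, but \<open>{x}\<close> is a null set of \<open>\<mu>\<close>.\<close>
    have "AE t in \<mu>. t \<notin> {x}"
      by (rule AE_not_in) (use x in \<open>auto simp: null_sets_def Herglotz_measure_sets[OF \<mu>]\<close>)
    then show "AE t in \<mu>. (\<lambda>n. of_real (y n) * k n t) \<longlonglongrightarrow> 0"
    proof eventually_elim
      case (elim t)
      then have "(\<lambda>n. of_real (y n) * k n t) \<longlonglongrightarrow> of_real 0 * (1 / (of_real t - of_real x) - of_real t / (of_real t ^ 2 + 1))"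
        unfolding k_def by (intro tendsto_intros y zlim) auto
      then show ?case by simp
    qed
  qed (auto simp: k_def)
  then have "(\<lambda>n. of_real (y n) * (LINT t|\<mu>. k n t)) \<longlonglongrightarrow> 0" by simp
  moreover have "(\<lambda>n. of_real (y n) * (of_real a + of_real b * z n)) \<longlonglongrightarrow> of_real 0 * (of_real a + of_real b * of_real x)"
    by (intro tendsto_intros y zlim)
  ultimately have "(\<lambda>n. of_real (y n) * (of_real a + of_real b * z n) + of_real (y n) * (LINT t|\<mu>. k n t)) \<longlonglongrightarrow> 0"
    using tendsto_add by fastforce
  then show ?thesis by (simp add: Herglotz_fun_def z_def k_def distrib_left)
qed

section \<open>The Herglotz representation theorem\<close>

lemma Cauchy_integral_unit_circle:
  assumes g: "continuous_on (cball 0 1) g" "g holomorphic_on ball 0 1" and w: "cmod w < 1"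
  shows "((\<lambda>\<theta>. g (cis \<theta>) * cis \<theta> / (cis \<theta> - w)) has_integral 2 * of_real pi * g w) {0..2 * pi}"
proof -
  have "((\<lambda>u. g u / (u - w)) has_contour_integral (2 * of_real pi * \<i> * g w)) (part_circlepath 0 1 0 (2 * pi))"
    using Cauchy_integral_circlepath[OF g, of w] w by (simp add: circlepath_def)
  then have "((\<lambda>\<theta>. g (cis \<theta>) / (cis \<theta> - w) * \<i> * cis \<theta>) has_integral 2 * of_real pi * \<i> * g w) {0..2 * pi}"
    by (subst (asm) has_contour_integral_part_circlepath_iff) (auto simp: mult_ac)
  from has_integral_mult_right[OF this, of "- \<i>"] show ?thesis
    by (simp add: field_simps)
qed

text \<open>
  Write \<open>Re f = (f + cnj f) / 2\<close>. The part with \<open>f\<close> is Cauchy's formula at \<open>w\<close>. For the part with \<open>cnj f\<close>,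
  the kernel is \<open>1 + 2 w / (\<zeta> - w)\<close>, and \<open>w / (\<zeta> - w)\<close> is on the unit circle the conjugate of \<open>cnj w \<zeta> / (1 - cnj w \<zeta>)\<close>,
  which is holomorphic in the disc and vanishes at \<open>0\<close>; so this part contributes only a multiple of
  \<open>cnj (f 0)\<close>.
\<close>
lemma Schwarz_integral_formula:
  assumes f: "continuous_on (cball 0 1) f" "f holomorphic_on ball 0 1" and w: "cmod w < 1"
  shows "((\<lambda>\<theta>. (cis \<theta> + w) / (cis \<theta> - w) * of_real (Re (f (cis \<theta>)))) has_integral
      2 * of_real pi * (f w - \<i> * of_real (Im (f 0)))) {0..2 * pi}"
proof -
  have ne: "cis \<theta> - w \<noteq> 0" for \<theta> using w by auto
  have ne': "1 - cnj w * z \<noteq> 0" if "cmod z \<le> 1" for z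
  proof -
    have "cmod (cnj w * z) < 1" using w that mult_le_one[of "cmod w" "cmod z"]
      mult_left_le[of "cmod z" "cmod w"] by (simp add: norm_mult)
    then show ?thesis by auto
  qed
  have 1: "((\<lambda>\<theta>. f (cis \<theta>) * cis \<theta> / (cis \<theta> - w)) has_integral 2 * of_real pi * f w) {0..2 * pi}"
    by (rule Cauchy_integral_unit_circle[OF f w])
  have 2: "((\<lambda>\<theta>. f (cis \<theta>)) has_integral 2 * of_real pi * f 0) {0..2 * pi}"
    using Cauchy_integral_unit_circle[OF f, of 0] by simp
  have 3: "((\<lambda>\<theta>. cnj (f (cis \<theta>))) has_integral 2 * of_real pi * cnj (f 0)) {0..2 * pi}"
    using has_integral_linear[OF 2 bounded_linear_cnj] by (simp add: o_def)
  have "((\<lambda>\<theta>. (f (cis \<theta>) * (cnj w * cis \<theta> / (1 - cnj w * cis \<theta>))) * cis \<theta> / (cis \<theta> - 0)) has_integral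
      2 * of_real pi * (f 0 * (cnj w * 0 / (1 - cnj w * 0)))) {0..2 * pi}"
    by (rule Cauchy_integral_unit_circle) (use ne' in \<open>auto intro!: continuous_intros holomorphic_intros f\<close>)
  then have "((\<lambda>\<theta>. f (cis \<theta>) * (cnj w * cis \<theta> / (1 - cnj w * cis \<theta>))) has_integral 0) {0..2 * pi}"
    by simp
  from has_integral_linear[OF this bounded_linear_cnj]
  have "((\<lambda>\<theta>. cnj (f (cis \<theta>)) * (w * cis (-\<theta>) / (1 - w * cis (-\<theta>)))) has_integral 0) {0..2 * pi}"
    by (simp add: o_def cis_cnj)
  moreover have "w * cis (-\<theta>) / (1 - w * cis (-\<theta>)) = w / (cis \<theta> - w)" for \<theta>
    using ne[of \<theta>] by (simp add: cis_inverse[symmetric] field_simps)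
  ultimately have 4: "((\<lambda>\<theta>. cnj (f (cis \<theta>)) * (w / (cis \<theta> - w))) has_integral 0) {0..2 * pi}"
    by simp
  have "((\<lambda>\<theta>. f (cis \<theta>) * cis \<theta> / (cis \<theta> - w) - f (cis \<theta>) * (1/2) + cnj (f (cis \<theta>)) * (1/2) + cnj (f (cis \<theta>)) * (w / (cis \<theta> - w)))
      has_integral (2 * of_real pi * f w - 2 * of_real pi * f 0 * (1/2) + 2 * of_real pi * cnj (f 0) * (1/2) + 0)) {0..2 * pi}"
    by (intro has_integral_add has_integral_diff has_integral_mult_left 1 2 3 4)
  moreover have "f (cis \<theta>) * cis \<theta> / (cis \<theta> - w) - f (cis \<theta>) * (1/2) + cnj (f (cis \<theta>)) * (1/2) + cnj (f (cis \<theta>)) * (w / (cis \<theta> - w))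
      = (cis \<theta> + w) / (cis \<theta> - w) * of_real (Re (f (cis \<theta>)))" for \<theta>
  proof -
    have "of_real (Re (f (cis \<theta>))) = (f (cis \<theta>) + cnj (f (cis \<theta>))) / 2"
      by (simp add: complex_add_cnj)
    moreover have "p * u / (u - w) - p * (1/2) + q * (1/2) + q * (w / (u - w)) = (u + w) / (u - w) * ((p + q) / 2)"
      if "u - w \<noteq> 0" for p q u :: complex
    proof -
      have "p * (d + w) / d - p * (1/2) + q * (1/2) + q * (w / d) = (d + w + w) / d * ((p + q) / 2)"
        if "d \<noteq> 0" for d
        using that by (simp add: field_simps)
      from this[OF that] show ?thesis by simp
    qed
    ultimately show ?thesis using ne[of \<theta>] by presburger
  qed
  moreover have "2 * of_real pi * f w - 2 * of_real pi * f 0 * (1/2) + 2 * of_real pi * cnj (f 0) * (1/2) + 0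
      = 2 * of_real pi * (f w - \<i> * of_real (Im (f 0)))"
    by (simp add: complex_eq_iff algebra_simps)
  ultimately show ?thesis by simp
qed

lemma Schwarz_kernel_bound:
  assumes "cmod w < 1"
  shows "cmod ((cis \<theta> + w) / (cis \<theta> - w)) \<le> 2 / (1 - cmod w)"
  unfolding norm_divide
  using assms norm_triangle_ineq[of "cis \<theta>" w] norm_triangle_ineq2[of "cis \<theta>" w]
  by (intro frac_le) auto

lemma Schwarz_kernel_isCont:
  assumes "cmod w < 1"
  shows "isCont (\<lambda>\<theta>. (cis \<theta> + w) / (cis \<theta> - w)) \<theta>"
proof -
  have "continuous_on UNIV (\<lambda>\<theta>. (cis \<theta> + w) / (cis \<theta> - w))"
    using assms by (intro continuous_intros) auto
  then show ?thesis by (simp add: continuous_on_eq_continuous_at)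
qed

text \<open>
  On circles of radius \<open>r < 1\<close> the Schwarz formula represents \<open>f (r w)\<close> by the measure with density
  \<open>Re f (r cis \<theta>)\<close>, whose mass \<open>2 pi Re (f 0)\<close> does not depend on \<open>r\<close>. After normalisation these are
  probability measures on a fixed bounded interval, so a subsequence converges weakly as \<open>r\<close>
  tends to \<open>1\<close>; the kernel is a bounded continuous function of \<open>\<theta>\<close>, so the formula survives.
\<close>
theorem Herglotz_representation_disc:
  assumes f: "f holomorphic_on ball 0 1" "\<And>w. cmod w < 1 \<Longrightarrow> Re (f w) > 0"
  obtains M where "real_distribution M"
    "\<And>w. cmod w < 1 \<Longrightarrow> f w = \<i> * of_real (Im (f 0)) + of_real (Re (f 0)) * (LINT \<theta>|M. (cis \<theta> + w) / (cis \<theta> - w))"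
proof -
  define c where "c = Re (f 0)"
  have c: "c > 0" using f(2)[of 0] by (simp add: c_def)
  define r where "r n = 1 - 1 / (real n + 2)" for n
  have r: "0 < r n" "r n < 1" for n by (auto simp: r_def field_simps)
  define fr where "fr n w = f (of_real (r n) * w)" for n w
  have small: "cmod (of_real (r n) * w) < 1" if "cmod w \<le> 1" for n w
  proof -
    have "r n * cmod w \<le> r n * 1" using that r[of n] by (intro mult_left_mono) auto
    also have "\<dots> < 1" using r[of n] by simp
    finally show ?thesis using r[of n] by (simp add: norm_mult)
  qed
  have hol: "fr n holomorphic_on ball 0 1" for n
    unfolding fr_def
    by (rule holomorphic_on_compose_gen[of "\<lambda>w. of_real (r n) * w" _ f, unfolded o_def, OF _ f(1)])
      (use small in \<open>auto intro!: holomorphic_intros\<close>)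
  have cont: "continuous_on (cball 0 1) (fr n)" for n
    unfolding fr_def
    by (intro continuous_on_compose2[OF holomorphic_on_imp_continuous_on[OF f(1)]] continuous_intros)
      (use small in auto)
  define p where "p n \<theta> = Re (fr n (cis \<theta>)) / (2 * pi * c)" for n \<theta>
  have contcis: "continuous_on UNIV (\<lambda>\<theta>. fr n (cis \<theta>))" for n
    by (intro continuous_on_compose2[OF cont] continuous_intros) auto
  have contp: "continuous_on UNIV (p n)" for n
    unfolding p_def using c by (intro continuous_intros contcis) auto
  have [measurable]: "p n \<in> borel_measurable borel" for n
    by (rule borel_measurable_continuous_onI[OF contp])
  have p: "p n \<theta> > 0" for n \<theta>
    using f(2)[OF small[of "cis \<theta>" n]] c by (simp add: p_def fr_def)
  define \<nu> where "\<nu> n = density lborel (\<lambda>\<theta>. ennreal (indicator {0..2 * pi} \<theta> * p n \<theta>))" for n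
  have integral_\<nu>: "(LINT \<theta>|\<nu> n. (cis \<theta> + w) / (cis \<theta> - w)) = (f (of_real (r n) * w) - \<i> * of_real (Im (f 0))) / of_real c"
    if w: "cmod w < 1" for n w
  proof -
    define k where "k \<theta> = (cis \<theta> + w) / (cis \<theta> - w)" for \<theta>
    have kc: "continuous_on UNIV k"
      unfolding k_def using Schwarz_kernel_isCont[OF w] by (simp add: continuous_on_eq_continuous_at)
    then have [measurable]: "k \<in> borel_measurable borel" by (rule borel_measurable_continuous_onI)
    have "((\<lambda>\<theta>. k \<theta> * of_real (Re (fr n (cis \<theta>))) * (1 / of_real (2 * pi * c))) has_integral
        2 * of_real pi * (fr n w - \<i> * of_real (Im (fr n 0))) * (1 / of_real (2 * pi * c))) {0..2 * pi}"
      unfolding k_def by (intro has_integral_mult_left Schwarz_integral_formula cont hol w)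
    moreover have "k \<theta> * of_real (Re (fr n (cis \<theta>))) * (1 / of_real (2 * pi * c)) = p n \<theta> *\<^sub>R k \<theta>" for \<theta>
      by (simp add: p_def scaleR_conv_of_real)
    moreover have "2 * of_real pi * (fr n w - \<i> * of_real (Im (fr n 0))) * (1 / of_real (2 * pi * c)) =
        (f (of_real (r n) * w) - \<i> * of_real (Im (f 0))) / of_real c"
      using c by (simp add: fr_def field_simps)
    ultimately have HK: "((\<lambda>\<theta>. p n \<theta> *\<^sub>R k \<theta>) has_integral (f (of_real (r n) * w) - \<i> * of_real (Im (f 0))) / of_real c) {0..2 * pi}"
      by (simp only:)
    have "(LINT \<theta>|\<nu> n. k \<theta>) = (LINT \<theta>|lborel. (indicator {0..2 * pi} \<theta> * p n \<theta>) *\<^sub>R k \<theta>)"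
      unfolding \<nu>_def
      by (intro integral_density) (auto intro!: AE_I2 mult_nonneg_nonneg less_imp_le[OF p])
    also have "\<dots> = (LINT \<theta>:{0..2 * pi}|lborel. p n \<theta> *\<^sub>R k \<theta>)"
      by (simp add: set_lebesgue_integral_def)
    also have "\<dots> = integral {0..2 * pi} (\<lambda>\<theta>. p n \<theta> *\<^sub>R k \<theta>)"
      by (intro set_borel_integral_eq_integral(2) borel_integrable_atLeastAtMost')
        (auto intro!: continuous_intros continuous_on_subset[OF contp] continuous_on_subset[OF kc])
    finally show ?thesis using integral_unique[OF HK] by (simp add: k_def)
  qed
  have total: "((\<lambda>\<theta>. p n \<theta>) has_integral 1) {0..2 * pi}" for n
  proof -
    have "((\<lambda>\<theta>. of_real (Re (fr n (cis \<theta>))) * (1 / of_real (2 * pi * c))) has_integral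
        2 * of_real pi * (fr n 0 - \<i> * of_real (Im (fr n 0))) * (1 / complex_of_real (2 * pi * c))) {0..2 * pi}"
      using has_integral_mult_left[OF Schwarz_integral_formula[OF cont[of n] hol[of n], of 0], of "1 / of_real (2 * pi * c)"] by simp
    from has_integral_linear[OF this bounded_linear_Re]
    show ?thesis using c by (simp add: o_def p_def fr_def c_def del: of_real_mult of_real_divide
      add: Re_divide_of_real)
  qed
  have dist: "real_distribution (\<nu> n)" for n
  proof -
    have "emeasure (\<nu> n) (space (\<nu> n)) = (\<integral>\<^sup>+ \<theta>. ennreal (indicator {0..2 * pi} \<theta> * p n \<theta>) \<partial>lborel)"
      unfolding \<nu>_def by (subst emeasure_density) auto
    also have "\<dots> = ennreal 1"
      by (rule nn_integral_has_integral_lebesgue[OF _ total]) (use p in \<open>auto intro: less_imp_le\<close>)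
    finally have "prob_space (\<nu> n)" by (intro prob_spaceI) simp
    then show ?thesis
      by (simp add: real_distribution_def real_distribution_axioms_def \<nu>_def)
  qed
  have "tight \<nu>"
    unfolding tight_def
  proof safe
    fix e :: real assume "e > 0"
    \<comment> \<open>The interval must be open on the left, so it starts at \<open>-1\<close> in order to contain \<open>[0, 2 pi]\<close>.\<close>
    have "measure (\<nu> n) {-1<..2 * pi} = 1" for n
    proof -
      interpret real_distribution "\<nu> n" by (rule dist)
      have "AE \<theta> in \<nu> n. \<theta> \<in> {-1<..2 * pi}"
        unfolding \<nu>_def by (subst AE_density) (auto intro!: AE_I2 split: split_indicator)
      then show ?thesis by (subst prob_eq_1) auto
    qed
    then show "\<exists>a b. a < b \<and> (\<forall>n. 1 - e < measure (\<nu> n) {a<..b})"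
      using \<open>e > 0\<close> by (intro exI[of _ "-1"] exI[of _ "2 * pi"]) (auto intro: less_le_trans[of _ 0])
  qed (rule dist)
  then obtain s M where s: "strict_mono s" and M: "real_distribution M" and conv: "weak_conv_m (\<nu> \<circ> id \<circ> s) M"
    using tight_imp_convergent_subsubsequence[of \<nu> id] by (auto simp: strict_mono_id)
  have "f w = \<i> * of_real (Im (f 0)) + of_real (Re (f 0)) * (LINT \<theta>|M. (cis \<theta> + w) / (cis \<theta> - w))"
    if w: "cmod w < 1" for w
  proof -
    have "(\<lambda>n. LINT \<theta>|(\<nu> \<circ> id \<circ> s) n. (cis \<theta> + w) / (cis \<theta> - w)) \<longlonglongrightarrow> (LINT \<theta>|M. (cis \<theta> + w) / (cis \<theta> - w))"
      by (rule weak_conv_imp_integral_bdd_continuous_conv[OF _ M conv Schwarz_kernel_isCont[OF w] Schwarz_kernel_bound[OF w]])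
        (simp add: dist)
    then have 1: "(\<lambda>n. (f (of_real (r (s n)) * w) - \<i> * of_real (Im (f 0))) / of_real c) \<longlonglongrightarrow> (LINT \<theta>|M. (cis \<theta> + w) / (cis \<theta> - w))"
      by (simp add: integral_\<nu>[OF w])
    have "r \<longlonglongrightarrow> 1" unfolding r_def by real_asymp
    then have "(\<lambda>n. r (s n)) \<longlonglongrightarrow> 1" using LIMSEQ_subseq_LIMSEQ[OF _ s] by (auto simp: o_def)
    then have "(\<lambda>n. of_real (r (s n)) * w) \<longlonglongrightarrow> of_real 1 * w" by (intro tendsto_intros)
    moreover have "isCont f w"
      using holomorphic_on_imp_continuous_on[OF f(1)] w by (simp add: continuous_on_eq_continuous_at)
    ultimately have "(\<lambda>n. f (of_real (r (s n)) * w)) \<longlonglongrightarrow> f w"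
      by (intro isCont_tendsto_compose[of w f]) auto
    then have "(\<lambda>n. (f (of_real (r (s n)) * w) - \<i> * of_real (Im (f 0))) / of_real c) \<longlonglongrightarrow> (f w - \<i> * of_real (Im (f 0))) / of_real c"
      using c by (intro tendsto_intros) auto
    from LIMSEQ_unique[OF 1 this] show ?thesis using c by (simp add: field_simps c_def)
  qed
  with M show ?thesis using that by blast
qed

text \<open>
  The map \<open>w \<mapsto> \<i> (1 + w) / (1 - w)\<close> takes the unit disc to the upper half plane and the unit circle, apart
  from \<open>1\<close>, to the real line; both facts are visible in this formula.
\<close>
lemma Im_Cayley: "Im (\<i> * (1 + w) / (1 - w)) = (1 - (cmod w)\<^sup>2) / (cmod (1 - w))\<^sup>2"
  unfolding cmod_power2 by (simp add: Im_divide power2_eq_square field_simps)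

text \<open>
  The Cayley transform carries the representation on the disc over to the half plane. For \<open>\<zeta> \<noteq> 1\<close> on the unit circle
  with image \<open>t\<close> on the real line, \<open>\<i> (\<zeta> + w) / (\<zeta> - w)\<close> is \<open>t\<^sup>2 + 1\<close> times the Herglotz kernel at \<open>t\<close>; the point
  \<open>\<zeta> = 1\<close> corresponds to infinity, and its mass becomes the coefficient \<open>b\<close> of the linear term.
\<close>
theorem Herglotz_representation:
  assumes F: "Herglotz F"
  obtains a b \<mu> where "b \<ge> 0" "Herglotz_measure \<mu>"
    "\<And>z. Im z > 0 \<Longrightarrow> F z = Herglotz_fun a b \<mu> z"
proof -
  have Fhol: "F holomorphic_on {z. Im z > 0}" and Fpos: "\<And>z. Im z > 0 \<Longrightarrow> Im (F z) > 0"
    using F by (auto simp: Herglotz_def upper_half_plane_def)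
  \<comment> \<open>The factor \<open>- \<i>\<close> turns the positive imaginary part into a positive real part.\<close>
  define f where "f w = - \<i> * F (\<i> * (1 + w) / (1 - w))" for w
  have Im_pos: "Im (\<i> * (1 + w) / (1 - w)) > 0" if "cmod w < 1" for w
  proof -
    have "w \<noteq> 1" "(cmod w)\<^sup>2 < 1" using that by (auto simp: abs_square_less_1)
    then show ?thesis unfolding Im_Cayley by simp
  qed
  have hol: "f holomorphic_on ball 0 1"
    unfolding f_def
    by (intro holomorphic_intros holomorphic_on_compose_gen[of "\<lambda>w. \<i> * (1 + w) / (1 - w)" _ F, unfolded o_def, OF _ Fhol])
      (use Im_pos in \<open>auto intro!: holomorphic_intros\<close>)
  have "Re (f w) > 0" if "cmod w < 1" for w using Fpos[OF Im_pos[OF that]] by (simp add: f_def)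
  from Herglotz_representation_disc[OF hol this]
  obtain M where M: "real_distribution M" and rep: "\<And>w. cmod w < 1 \<Longrightarrow>
      f w = \<i> * of_real (Im (f 0)) + of_real (Re (f 0)) * (LINT \<theta>|M. (cis \<theta> + w) / (cis \<theta> - w))"
    by blast
  interpret real_distribution M by (rule M)
  define c where "c = Re (f 0)"
  have c: "c > 0" using \<open>\<And>w. cmod w < 1 \<Longrightarrow> Re (f w) > 0\<close>[of 0] by (simp add: c_def)
  \<comment> \<open>Where \<open>cis \<theta> = 1\<close>, division by zero gives \<open>T \<theta> = 0\<close>; the weight \<open>h\<close> vanishes there, so that the mass at infinity is not moved to \<open>0\<close>.\<close>
  define T where "T \<theta> = Re (\<i> * (1 + cis \<theta>) / (1 - cis \<theta>))" for \<theta>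
  define Q where "Q = {\<theta>. cis \<theta> = 1}"
  have [measurable]: "cis \<in> borel_measurable borel"
    by (intro borel_measurable_continuous_onI continuous_intros)
  have [measurable]: "T \<in> borel_measurable borel" unfolding T_def by measurable
  have [measurable]: "Q \<in> sets borel" unfolding Q_def by measurable
  have T: "of_real (T \<theta>) = \<i> * (1 + cis \<theta>) / (1 - cis \<theta>)" for \<theta>
  proof -
    have "Im (\<i> * (1 + cis \<theta>) / (1 - cis \<theta>)) = 0" unfolding Im_Cayley by simp
    then show ?thesis by (simp add: T_def complex_eq_iff del: times_divide_eq_right)
  qed
  define h where "h \<theta> = c * (1 + (T \<theta>)\<^sup>2) * indicator (- Q) \<theta>" for \<theta>
  have [measurable]: "h \<in> borel_measurable borel" unfolding h_def by measurable
  have h: "h \<theta> \<ge> 0" for \<theta> using c by (simp add: h_def)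
  define \<mu> where "\<mu> = distr (density M (\<lambda>\<theta>. ennreal (h \<theta>))) borel T"
  have sets: "sets \<mu> = sets borel" by (simp add: \<mu>_def)
  have "(\<integral>\<^sup>+ t. ennreal (1 / (t\<^sup>2 + 1)) \<partial>\<mu>) = (\<integral>\<^sup>+ \<theta>. ennreal (h \<theta>) * ennreal (1 / ((T \<theta>)\<^sup>2 + 1)) \<partial>M)"
    unfolding \<mu>_def by (subst nn_integral_distr) (auto simp: nn_integral_density)
  also have "\<dots> \<le> (\<integral>\<^sup>+ \<theta>. ennreal c \<partial>M)"
  proof (intro nn_integral_mono)
    fix \<theta>
    have "(T \<theta>)\<^sup>2 + 1 > 0" by (simp add: add_nonneg_pos)
    then have "h \<theta> * (1 / ((T \<theta>)\<^sup>2 + 1)) \<le> c" using c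
      by (simp add: h_def add.commute split: split_indicator)
    then show "ennreal (h \<theta>) * ennreal (1 / ((T \<theta>)\<^sup>2 + 1)) \<le> ennreal c"
      using h by (subst ennreal_mult[symmetric]) (auto intro: ennreal_leI)
  qed
  also have "\<dots> < \<infinity>" using emeasure_space_1 by (simp add: ennreal_mult_less_top)
  finally have \<mu>: "Herglotz_measure \<mu>" using sets by (simp add: Herglotz_measure_def)
  define b where "b = c * measure M Q"
  have "F z = Herglotz_fun (- Im (f 0)) b \<mu> z" if z: "Im z > 0" for z
  proof -
    define w where "w = (z - \<i>) / (z + \<i>)"
    have zi: "z + \<i> \<noteq> 0" using z by (auto simp: complex_eq_iff)
    have "(cmod (z - \<i>))\<^sup>2 < (cmod (z + \<i>))\<^sup>2"
      unfolding cmod_power2 using z by (simp add: power2_eq_square algebra_simps)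
    then have "cmod (z - \<i>) < cmod (z + \<i>)" by (rule power2_less_imp_less) simp
    then have w: "cmod w < 1" by (simp add: w_def norm_divide divide_less_eq)
    then have w1: "1 - w \<noteq> 0" by auto
    have zw: "\<i> * (1 + w) / (1 - w) = z"
    proof -
      have "1 - w = 2 * \<i> / (z + \<i>)" "1 + w = 2 * z / (z + \<i>)" using zi by (simp_all add: w_def field_simps)
      then show ?thesis using zi by simp
    qed
    define k where "k t = 1 / (complex_of_real t - z) - of_real t / (of_real t ^ 2 + 1)" for t
    have [measurable]: "k \<in> borel_measurable borel" unfolding k_def by measurable
    have pointwise: "of_real c * \<i> * ((cis \<theta> + w) / (cis \<theta> - w)) = h \<theta> *\<^sub>R k (T \<theta>) + indicator Q \<theta> *\<^sub>R (of_real c * z)" for \<theta>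
    proof (cases "\<theta> \<in> Q")
      case True
      then have "cis \<theta> = 1" by (simp add: Q_def)
      then show ?thesis using True by (simp add: h_def zw[symmetric])
    next
      case False
      then have ne: "cis \<theta> \<noteq> 1" by (simp add: Q_def)
      have pos: "1 + (T \<theta>)\<^sup>2 \<noteq> 0" using add_pos_nonneg[of 1 "(T \<theta>)\<^sup>2"] by auto
      have "h \<theta> *\<^sub>R k (T \<theta>) = of_real (c * (1 + (T \<theta>)\<^sup>2)) * ((z + (1 + z\<^sup>2) / (of_real (T \<theta>) - z)) / of_real ((T \<theta>)\<^sup>2 + 1))"
        using False by (simp add: h_def k_def Herglotz_kernel_eq[OF z] scaleR_conv_of_real)
      also have "\<dots> = of_real c * (z + (1 + z\<^sup>2) / (of_real (T \<theta>) - z))"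
      proof -
        have "of_real (1 + (T \<theta>)\<^sup>2) * (X / of_real ((T \<theta>)\<^sup>2 + 1)) = (X :: complex)" for X
          using pos by (metis add.commute nonzero_mult_div_cancel_left of_real_eq_0_iff times_divide_eq_right)
        then show ?thesis by (simp only: of_real_mult mult.assoc)
      qed
      also have "z + (1 + z\<^sup>2) / (of_real (T \<theta>) - z) = \<i> * ((cis \<theta> + w) / (cis \<theta> - w))"
      proof -
        define u where "u = cis \<theta>"
        have u: "1 - u \<noteq> 0" "u - w \<noteq> 0" using ne w by (auto simp: u_def)
        have zz: "z = \<i> * (1 + w) / (1 - w)" using zw by simp
        have diff: "of_real (T \<theta>) - z = 2 * \<i> * (u - w) / ((1 - u) * (1 - w))"
          unfolding T zz u_def[symmetric] using u w1 by (simp add: field_simps)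
        have "z\<^sup>2 = - ((1 + w)\<^sup>2 / (1 - w)\<^sup>2)"
          unfolding zz by (simp add: power_mult_distrib power_divide)
        then have "1 + z\<^sup>2 = ((1 - w)\<^sup>2 - (1 + w)\<^sup>2) / (1 - w)\<^sup>2"
          using w1 by (simp add: diff_divide_distrib)
        also have "(1 - w)\<^sup>2 - (1 + w)\<^sup>2 = - 4 * w" by (simp add: power2_eq_square algebra_simps)
        finally have sq: "1 + z\<^sup>2 = - 4 * w / (1 - w)\<^sup>2" .
        have frac: "(1 + z\<^sup>2) / (of_real (T \<theta>) - z) = 2 * \<i> * w * (1 - u) / ((1 - w) * (u - w))"
          unfolding diff sq using u w1 by (simp add: power2_eq_square divide_simps)
        have "\<i> * (1 + w) / (1 - w) + 2 * \<i> * w * (1 - u) / ((1 - w) * (u - w)) = \<i> * ((u + w) / (u - w))"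
          using u w1 by (simp add: divide_simps) (simp add: algebra_simps)
        then show ?thesis unfolding frac u_def[symmetric] zw .
      qed
      finally show ?thesis using False by (simp add: mult.assoc)
    qed
    have int1: "integrable M (\<lambda>\<theta>. h \<theta> *\<^sub>R k (T \<theta>))"
    proof -
      have "integrable \<mu> k" unfolding k_def by (rule Herglotz_kernel_integrable[OF \<mu> z])
      then have "integrable (density M (\<lambda>\<theta>. ennreal (h \<theta>))) (\<lambda>\<theta>. k (T \<theta>))"
        unfolding \<mu>_def by (subst (asm) integrable_distr_eq) auto
      then show ?thesis by (subst (asm) integrable_density) (use h in auto)
    qed
    have int2: "integrable M (\<lambda>\<theta>. indicator Q \<theta> *\<^sub>R (of_real c * z))"
      by (intro integrable_scaleR_left integrable_real_indicator) (auto simp: emeasure_eq_measure)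
    have "F z = \<i> * f w" unfolding f_def zw by simp
    also have "\<dots> = - of_real (Im (f 0)) + of_real c * \<i> * (LINT \<theta>|M. (cis \<theta> + w) / (cis \<theta> - w))"
      unfolding rep[OF w] by (simp add: c_def algebra_simps)
    also have "of_real c * \<i> * (LINT \<theta>|M. (cis \<theta> + w) / (cis \<theta> - w)) = (LINT \<theta>|M. of_real c * \<i> * ((cis \<theta> + w) / (cis \<theta> - w)))"
      by (rule integral_mult_right_zero[symmetric])
    also have "\<dots> = (LINT \<theta>|M. h \<theta> *\<^sub>R k (T \<theta>)) + (LINT \<theta>|M. indicator Q \<theta> *\<^sub>R (of_real c * z))"
      unfolding pointwise by (rule Bochner_Integration.integral_add[OF int1 int2])
    also have "(LINT \<theta>|M. h \<theta> *\<^sub>R k (T \<theta>)) = (LINT t|\<mu>. k t)"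
      unfolding \<mu>_def using h by (subst integral_distr) (auto simp: integral_density)
    also have "(LINT \<theta>|M. indicator Q \<theta> *\<^sub>R (of_real c * z)) = of_real b * z"
      by (simp add: b_def scaleR_conv_of_real)
    finally show ?thesis by (simp add: Herglotz_fun_def k_def)
  qed
  moreover have "b \<ge> 0" using c by (simp add: b_def)
  ultimately show ?thesis using \<mu> that by blast
qed

section \<open>An atom bounds the deviation of the argument\<close>

text \<open>
  Cauchy's theorem for \<open>L (z) / z\<close> on the upper half of the annulus \<open>d \<le> \<bar>z\<bar> \<le> 1\<close>. The substitution \<open>z = exp s\<close>
  turns the half annulus into a rectangle, which is convex, so \<open>L (exp s)\<close> has a primitive there;
  the identity says that its increments along the four sides add up to zero.
\<close>
lemma half_annulus_integral:
  fixes L :: "complex \<Rightarrow> complex"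
  assumes d: "0 < d" "d < 1" and L: "L holomorphic_on S" "{z. Im z \<ge> 0 \<and> z \<noteq> 0} \<subseteq> S"
  shows "((\<lambda>t. (L (of_real t) - L (- of_real t)) / of_real t) has_integral
           \<i> * (integral {0..pi} (\<lambda>\<theta>. L (of_real d * cis \<theta>)) - integral {0..pi} (\<lambda>\<theta>. L (cis \<theta>)))) {d..1}"
proof -
  define R where "R = cbox (Complex (ln d) 0) (Complex 0 pi)"
  have R: "s \<in> R \<longleftrightarrow> ln d \<le> Re s \<and> Re s \<le> 0 \<and> 0 \<le> Im s \<and> Im s \<le> pi" for s
    by (auto simp: R_def in_cbox_complex_iff)
  have expS: "exp s \<in> S" if "s \<in> R" for s
    using that L(2) by (auto simp: R Im_exp sin_ge_zero)
  have hol: "(\<lambda>s. L (exp s)) holomorphic_on R"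
    using holomorphic_on_compose_gen[of exp R L S] L(1) expS
    by (auto simp: o_def image_subset_iff holomorphic_on_exp)
  obtain P where P: "\<And>s. s \<in> R \<Longrightarrow> (P has_field_derivative L (exp s)) (at s within R)"
  proof (rule holomorphic_convex_primitive[of R "{}" "\<lambda>s. L (exp s)"])
    show "convex R" by (simp add: R_def)
    show "continuous_on R (\<lambda>s. L (exp s))" using hol holomorphic_on_imp_continuous_on by blast
    show "(\<lambda>s. L (exp s)) field_differentiable at s" if "s \<in> interior R - {}" for s
      using that hol holomorphic_on_imp_differentiable_at holomorphic_on_subset interior_subset open_interior by blast
  qed auto
  have side: "((\<lambda>t. L (exp (g t)) * g' t) has_integral (P (g b) - P (g a))) {a..b}"
    if "a \<le> b" "\<And>t. t \<in> {a..b} \<Longrightarrow> (g has_vector_derivative g' t) (at t within {a..b})"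
      "\<And>t. t \<in> {a..b} \<Longrightarrow> g t \<in> R" for g g' a b
  proof (rule fundamental_theorem_of_calculus[OF that(1)])
    fix t assume t: "t \<in> {a..b}"
    have "((P \<circ> g) has_vector_derivative (g' t * L (exp (g t)))) (at t within {a..b})"
      by (rule field_vector_diff_chain_within[OF that(2)[OF t]])
        (rule DERIV_subset[OF P[OF that(3)[OF t]]], use that(3) in auto)
    then show "((\<lambda>t. P (g t)) has_vector_derivative L (exp (g t)) * g' t) (at t within {a..b})"
      by (simp add: o_def mult.commute)
  qed
  have lnd: "ln d < 0" using d by simp
  have lnt: "ln d \<le> ln t" "ln t \<le> 0" if "t \<in> {d..1}" for t
    using that d by auto
  \<comment> \<open>The horizontal sides are parametrised by \<open>s = ln t\<close> and \<open>s = ln t + \<i> pi\<close>, so that \<open>exp s\<close> runs through \<open>t\<close> and \<open>- t\<close>.\<close>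
  have b: "((\<lambda>t. L (exp (of_real (ln t))) * of_real (1 / t)) has_integral (P (of_real (ln 1)) - P (of_real (ln d)))) {d..1}"
    by (rule side) (use d lnt in \<open>auto simp: R intro!: derivative_eq_intros has_vector_derivative_real_field simp: has_real_derivative_iff_has_vector_derivative[symmetric]\<close>)
  have t: "((\<lambda>t. L (exp (of_real (ln t) + \<i> * pi)) * of_real (1 / t)) has_integral
      (P (of_real (ln 1) + \<i> * pi) - P (of_real (ln d) + \<i> * pi))) {d..1}"
    by (rule side) (use d lnt in \<open>auto simp: R intro!: derivative_eq_intros has_vector_derivative_real_field simp: has_real_derivative_iff_has_vector_derivative[symmetric]\<close>)
  have v: "((\<lambda>\<theta>. L (exp (of_real u + \<i> * of_real \<theta>)) * \<i>) has_integral
      (P (of_real u + \<i> * of_real pi) - P (of_real u + \<i> * of_real 0))) {0..pi}" if "ln d \<le> u" "u \<le> 0" for u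
    by (rule side) (use that in \<open>auto simp: R intro!: derivative_eq_intros\<close>)
  have r: "((\<lambda>\<theta>. L (cis \<theta>) * \<i>) has_integral (P (\<i> * pi) - P 0)) {0..pi}"
    using v[of 0] lnd by (simp add: cis_conv_exp)
  have l: "((\<lambda>\<theta>. L (of_real d * cis \<theta>) * \<i>) has_integral (P (of_real (ln d) + \<i> * pi) - P (of_real (ln d)))) {0..pi}"
    using v[of "ln d"] lnd d by (simp add: cis_conv_exp exp_add exp_of_real)
  have "((\<lambda>t. L (of_real t) / of_real t - L (- of_real t) / of_real t) has_integral
      (P 0 - P (of_real (ln d))) - (P (\<i> * pi) - P (of_real (ln d) + \<i> * pi))) {d..1}"
  proof (intro has_integral_diff)
    show "((\<lambda>t. L (of_real t) / of_real t) has_integral P 0 - P (of_real (ln d))) {d..1}"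
      by (rule has_integral_eq[OF _ b[simplified]]) (use d in \<open>auto simp: exp_of_real divide_inverse\<close>)
    show "((\<lambda>t. L (- of_real t) / of_real t) has_integral P (\<i> * pi) - P (of_real (ln d) + \<i> * pi)) {d..1}"
      by (rule has_integral_eq[OF _ t[simplified]]) (use d in \<open>auto simp: exp_add exp_of_real divide_inverse\<close>)
  qed
  also have "(P 0 - P (of_real (ln d))) - (P (\<i> * pi) - P (of_real (ln d) + \<i> * pi)) =
     integral {0..pi} (\<lambda>\<theta>. L (of_real d * cis \<theta>) * \<i>) - integral {0..pi} (\<lambda>\<theta>. L (cis \<theta>) * \<i>)"
    unfolding integral_unique[OF r] integral_unique[OF l] by simp
  also have "\<dots> = \<i> * (integral {0..pi} (\<lambda>\<theta>. L (of_real d * cis \<theta>)) - integral {0..pi} (\<lambda>\<theta>. L (cis \<theta>)))"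
    by (simp add: algebra_simps)
  finally show ?thesis by (simp add: diff_divide_distrib)
qed

text \<open>
  Together with the next lemma this bounds the integral of \<open>- ln (sin \<theta>)\<close>. The majorant is chosen because its
  antiderivative is explicit: \<open>4 sqrt (sin \<theta>)\<close> up to sign.
\<close>
lemma has_integral_abs_cos_div_sqrt_sin:
  "((\<lambda>\<theta>. 2 * \<bar>cos \<theta>\<bar> / sqrt (sin \<theta>)) has_integral 8) {0..pi}"
proof -
  have 1: "((\<lambda>\<theta>. 2 * \<bar>cos \<theta>\<bar> / sqrt (sin \<theta>)) has_integral (4 * sqrt (sin (pi/2)) - 4 * sqrt (sin 0))) {0..pi/2}"
  proof (rule fundamental_theorem_of_calculus_interior)
    show "continuous_on {0..pi/2} (\<lambda>x. 4 * sqrt (sin x))" by (intro continuous_intros)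
    fix x assume x: "x \<in> {0<..<pi/2}"
    then have "sin x > 0" "cos x > 0" by (auto intro: sin_gt_zero cos_gt_zero_pi)
    then show "((\<lambda>x. 4 * sqrt (sin x)) has_vector_derivative 2 * \<bar>cos x\<bar> / sqrt (sin x)) (at x)"
      unfolding has_real_derivative_iff_has_vector_derivative[symmetric]
      by (auto intro!: derivative_eq_intros simp: field_simps)
  qed auto
  have 2: "((\<lambda>\<theta>. 2 * \<bar>cos \<theta>\<bar> / sqrt (sin \<theta>)) has_integral (- 4 * sqrt (sin pi) - (- 4 * sqrt (sin (pi/2))))) {pi/2..pi}"
  proof (rule fundamental_theorem_of_calculus_interior)
    show "continuous_on {pi/2..pi} (\<lambda>x. - 4 * sqrt (sin x))" by (intro continuous_intros)
    fix x assume x: "x \<in> {pi/2<..<pi}"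
    then have "sin x > 0" "cos x < 0" by (auto intro: sin_gt_zero cos_lt_zero_pi)
    then show "((\<lambda>x. - 4 * sqrt (sin x)) has_vector_derivative 2 * \<bar>cos x\<bar> / sqrt (sin x)) (at x)"
      unfolding has_real_derivative_iff_has_vector_derivative[symmetric]
      by (auto intro!: derivative_eq_intros simp: field_simps)
  qed auto
  show ?thesis
    using has_integral_combine[OF _ _ 1 2] by simp
qed

lemma neg_ln_sin_le:
  assumes "0 < \<theta>" "\<theta> < pi"
  shows "- ln (sin \<theta>) \<le> 2 * \<bar>cos \<theta>\<bar> / sqrt (sin \<theta>)"
proof -
  define s where "s = sqrt (sin \<theta>)"
  have sin: "sin \<theta> > 0" using assms by (rule sin_gt_zero)
  have s: "s > 0" "s \<le> 1" "sin \<theta> = s\<^sup>2" using sin by (auto simp: s_def)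
  have "(1 - s)\<^sup>2 \<le> 1 - s" using s by (simp add: power2_eq_square mult_left_le)
  also have "\<dots> \<le> (1 - s) * ((1 + s) * (1 + s\<^sup>2))"
    using s mult_left_mono[of 1 "(1 + s) * (1 + s\<^sup>2)" "1 - s"] by (simp add: algebra_simps)
  also have "\<dots> = (cos \<theta>)\<^sup>2" 
    unfolding cos_squared_eq s(3) by (simp add: algebra_simps power2_eq_square)
  finally have "1 - s \<le> \<bar>cos \<theta>\<bar>" using s by (simp add: abs_le_square_iff[symmetric])
  have "- ln (sin \<theta>) = 2 * ln (1 / s)" using s by (simp add: ln_div ln_realpow)
  also have "ln (1 / s) \<le> 1 / s - 1" using s by (intro ln_le_minus_one) auto
  also have "1 / s - 1 = (1 - s) / s" using s by (simp add: field_simps)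
  also have "\<dots> \<le> \<bar>cos \<theta>\<bar> / s" using s \<open>1 - s \<le> \<bar>cos \<theta>\<bar>\<close> by (intro divide_right_mono) auto
  finally show ?thesis by (simp add: s_def)
qed

text \<open>
  This is the half annulus formula for \<open>L = Ln G\<close>, centred at \<open>x + \<i>\<delta>\<close> and with inner radius \<open>\<delta>\<close>. Its
  imaginary part compares the arguments to the right and to the left of \<open>x\<close> with the means of \<open>ln \<bar>G\<bar>\<close> over
  the two half circles. The extremal arguments \<open>\<pi>\<close> and \<open>0\<close> contribute \<open>- \<pi> ln \<delta>\<close>, which cancels against the
  growth of \<open>ln \<bar>G\<bar>\<close> on the inner half circle. What remains does not depend on \<open>\<delta>\<close>.
\<close>
lemma argument_deficiency_bound:
  fixes G :: "complex \<Rightarrow> complex" and x m C \<delta> :: real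
  defines "A \<equiv> \<lambda>t. Arg (G (of_real t + \<i> * of_real \<delta>))"
  assumes G: "G holomorphic_on {z. Im z > 0}" "\<And>z. Im z > 0 \<Longrightarrow> Im (G z) > 0"
    and lower: "\<And>z. Im z > 0 \<Longrightarrow> m * Im z / (cmod (z - of_real x))\<^sup>2 \<le> Im (G z)"
    and upper: "\<And>z. Im z > 0 \<Longrightarrow> cmod (z - of_real x) \<le> 2 \<Longrightarrow> cmod (G z) \<le> C / Im z"
    and pos: "m > 0" "C > 0" "0 < \<delta>" "\<delta> < 1"
  shows "\<exists>I \<le> pi * ln C - pi * ln (m / 4) + 8.
           ((\<lambda>t. (pi - A (x + t) + A (x - t)) / t) has_integral I) {\<delta>..1}"
proof -
  define L where "L z = Ln (G (of_real x + \<i> * of_real \<delta> + z))" for z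
  have nr: "G z \<notin> \<real>\<^sub>\<le>\<^sub>0" "G z \<noteq> 0" if "Im z > 0" for z
    using G(2)[OF that] by (auto simp: complex_nonpos_Reals_iff)
  have "(\<lambda>z. G (of_real x + \<i> * of_real \<delta> + z)) holomorphic_on {z. Im z > - \<delta>}"
    by (rule holomorphic_on_compose_gen[of "\<lambda>z. of_real x + \<i> * of_real \<delta> + z" _ G, unfolded o_def, OF _ G(1)])
      (auto intro!: holomorphic_intros)
  then have L: "L holomorphic_on {z. Im z > - \<delta>}"
    unfolding L_def using nr by (intro holomorphic_intros) auto
  have ImL: "Im (L z) = Arg (G (of_real x + \<i> * of_real \<delta> + z))" "Re (L z) = ln (cmod (G (of_real x + \<i> * of_real \<delta> + z)))"
    if "Im z > - \<delta>" for z
    using nr[of "of_real x + \<i> * of_real \<delta> + z"] that by (auto simp: L_def Arg_eq_Im_Ln)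
  have up: "Im (of_real r * cis \<theta>) > - \<delta>" if "r \<ge> 0" "\<theta> \<in> {0..pi}" for r \<theta>
    using that pos mult_nonneg_nonneg[OF that(1) sin_ge_zero[of \<theta>]] by simp
  have int: "(\<lambda>\<theta>. L (of_real r * cis \<theta>)) integrable_on {0..pi}" if "r \<ge> 0" for r
  proof (intro integrable_continuous_real continuous_on_compose2[OF holomorphic_on_imp_continuous_on[OF L]])
    show "continuous_on {0..pi} (\<lambda>\<theta>. of_real r * cis \<theta>)" by (intro continuous_intros)
  qed (use up that in blast)
  define I1 where "I1 = integral {0..pi} (\<lambda>\<theta>. L (of_real \<delta> * cis \<theta>))"
  define I2 where "I2 = integral {0..pi} (\<lambda>\<theta>. L (cis \<theta>))"
  have I1: "((\<lambda>\<theta>. L (of_real \<delta> * cis \<theta>)) has_integral I1) {0..pi}"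
    using int[of \<delta>] pos by (auto simp: I1_def)
  have I2: "((\<lambda>\<theta>. L (cis \<theta>)) has_integral I2) {0..pi}"
    using int[of 1] by (auto simp: I2_def)
  have "((\<lambda>t. (L (of_real t) - L (- of_real t)) / of_real t) has_integral \<i> * (I1 - I2)) {\<delta>..1}"
    unfolding I1_def I2_def by (rule half_annulus_integral[OF _ _ L]) (use pos in auto)
  note Im_part = has_integral_linear[OF this bounded_linear_Im]
  have "((\<lambda>t. (A (x + t) - A (x - t)) / t) has_integral Im (\<i> * (I1 - I2))) {\<delta>..1}"
    by (rule has_integral_eq[OF _ Im_part])
      (use pos in \<open>auto simp: o_def Im_divide_of_real ImL A_def algebra_simps\<close>)
  then have "((\<lambda>t. (A (x + t) - A (x - t)) / t) has_integral Re I1 - Re I2) {\<delta>..1}" by simp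
  moreover have "((\<lambda>t. pi / t) has_integral (pi * ln 1 - pi * ln \<delta>)) {\<delta>..1}"
    by (rule fundamental_theorem_of_calculus)
      (use pos in \<open>auto intro!: derivative_eq_intros simp: has_real_derivative_iff_has_vector_derivative[symmetric]\<close>)
  ultimately have "((\<lambda>t. pi / t - (A (x + t) - A (x - t)) / t) has_integral (pi * ln 1 - pi * ln \<delta>) - (Re I1 - Re I2)) {\<delta>..1}"
    by (rule has_integral_diff[rotated])
  moreover have "(\<lambda>t. pi / t - (A (x + t) - A (x - t)) / t) = (\<lambda>t. (pi - A (x + t) + A (x - t)) / t)"
    by (simp add: fun_eq_iff diff_divide_distrib add_divide_distrib)
  \<comment> \<open>On the inner half circle \<open>\<bar>z - x\<bar> \<le> 2 \<delta>\<close> and \<open>Im z \<ge> \<delta>\<close>, so the lower bound gives \<open>\<bar>G z\<bar> \<ge> m / (4 \<delta>)\<close>.\<close>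
  moreover have "Re I1 \<ge> pi * (ln (m / 4) - ln \<delta>)"
  proof -
    have "((\<lambda>\<theta>. ln (m / 4) - ln \<delta>) has_integral pi * (ln (m / 4) - ln \<delta>)) {0..pi}"
      using has_integral_const_real[of "ln (m / 4) - ln \<delta>" 0 pi] by simp
    then show ?thesis
    proof (rule has_integral_le[OF _ has_integral_linear[OF I1 bounded_linear_Re]])
      fix \<theta> assume "\<theta> \<in> {0..pi}"
      then have sin: "sin \<theta> \<ge> 0" by (simp add: sin_ge_zero)
      define z where "z = of_real x + \<i> * of_real \<delta> + of_real \<delta> * cis \<theta>"
      have Imz: "Im z = \<delta> + \<delta> * sin \<theta>" by (simp add: z_def)
      have z: "Im z \<ge> \<delta>" using sin pos by (simp add: Imz)
      have "cmod (z - of_real x) = cmod (of_real \<delta> * (\<i> + cis \<theta>))" by (simp add: z_def algebra_simps)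
      also have "\<dots> \<le> 2 * \<delta>" using norm_triangle_ineq[of \<i> "cis \<theta>"] pos by (simp add: norm_mult)
      finally have le: "cmod (z - of_real x) \<le> 2 * \<delta>" .
      have "z \<noteq> of_real x" using z pos by auto
      have "m / 4 / \<delta> = m * \<delta> / (2 * \<delta>)\<^sup>2" using pos by (simp add: field_simps power2_eq_square)
      also have "\<dots> \<le> m * Im z / (cmod (z - of_real x))\<^sup>2"
        using z pos le \<open>z \<noteq> of_real x\<close> by (intro frac_le mult_mono power_mono) auto
      also have "\<dots> \<le> Im (G z)" using z pos by (intro lower) auto
      also have "\<dots> \<le> cmod (G z)" by (rule order_trans[OF abs_ge_self abs_Im_le_cmod])
      finally have "ln (m / 4 / \<delta>) \<le> ln (cmod (G z))" using pos by (intro ln_mono) auto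
      then show "ln (m / 4) - ln \<delta> \<le> (Re \<circ> (\<lambda>\<theta>. L (of_real \<delta> * cis \<theta>))) \<theta>"
        using pos ImL(2)[OF up[of \<delta> \<theta>]] \<open>\<theta> \<in> {0..pi}\<close> ln_div[of "m / 4" \<delta>]
        by (simp add: z_def del: ln_div)
    qed
  qed
  \<comment> \<open>On the outer half circle \<open>Im z \<ge> sin \<theta>\<close>; at the two end points this gives no bound, hence the open interval.\<close>
  moreover have "Re I2 \<le> pi * ln C + 8"
  proof -
    have 1: "((\<lambda>\<theta>. ln C + 2 * \<bar>cos \<theta>\<bar> / sqrt (sin \<theta>)) has_integral pi * ln C + 8) {0..pi}"
      using has_integral_add[OF has_integral_const_real[of "ln C" 0 pi] has_integral_abs_cos_div_sqrt_sin] by simp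
    have 2: "((\<lambda>\<theta>. Re (L (cis \<theta>))) has_integral Re I2) {0..pi}"
      using has_integral_linear[OF I2 bounded_linear_Re] by (simp add: o_def)
    show ?thesis
    proof (rule has_integral_le[OF 2[unfolded has_integral_Icc_iff_Ioo] 1[unfolded has_integral_Icc_iff_Ioo]])
      fix \<theta> assume \<theta>: "\<theta> \<in> {0<..<pi}"
      then have sin: "sin \<theta> > 0" by (simp add: sin_gt_zero)
      define z where "z = of_real x + \<i> * of_real \<delta> + cis \<theta>"
      have Imz: "Im z = \<delta> + sin \<theta>" by (simp add: z_def)
      have "cmod (z - of_real x) \<le> 2" using norm_triangle_ineq[of "\<i> * of_real \<delta>" "cis \<theta>"] pos
        by (simp add: z_def norm_mult)
      then have "cmod (G z) \<le> C / Im z" using Imz sin pos by (intro upper) auto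
      also have "\<dots> \<le> C / sin \<theta>" using Imz sin pos by (intro divide_left_mono) auto
      finally have "ln (cmod (G z)) \<le> ln (C / sin \<theta>)" using nr[of z] Imz sin pos by (intro ln_mono) auto
      also have "\<dots> \<le> ln C + 2 * \<bar>cos \<theta>\<bar> / sqrt (sin \<theta>)"
        using neg_ln_sin_le[of \<theta>] \<theta> sin pos by (simp add: ln_div)
      finally show "Re (L (cis \<theta>)) \<le> ln C + 2 * \<bar>cos \<theta>\<bar> / sqrt (sin \<theta>)"
        using \<theta> pos ImL(2)[OF up[of 1 \<theta>]] by (simp add: z_def)
    qed
  qed
  ultimately show ?thesis
    by (intro exI[of _ "(pi * ln 1 - pi * ln \<delta>) - (Re I1 - Re I2)"]) (auto simp: algebra_simps)
qed

text \<open>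
  The truncated integrals are those of \<open>argument_deficiency_bound\<close> along \<open>\<delta> = 1 / (n + 2)\<close>. A uniform bound for them passes to the
  limit \<open>c / t\<close> of the integrands on \<open>S\<close>, and the factor \<open>c\<close> can be divided out.
\<close>
lemma nn_integral_finite_by_Fatou:
  fixes b :: "nat \<Rightarrow> real \<Rightarrow> real"
  assumes [measurable]: "\<And>n. b n \<in> borel_measurable borel" "S \<in> sets borel"
    and bound: "\<And>n. (\<integral>\<^sup>+ t. ennreal (b n t / t) * indicator {1 / (real n + 2)..1} t \<partial>lborel) \<le> ennreal B"
    and lim: "AE t in lborel. t \<in> S \<longrightarrow> (\<lambda>n. b n t) \<longlonglongrightarrow> c" and c: "c > 0"
  shows "(\<integral>\<^sup>+ t. ennreal (indicator S t / t) * indicator {0<..1} t \<partial>lborel) < \<infinity>"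
proof -
  define f where "f t = ennreal (indicator S t / t) * indicator {0<..1} t" for t :: real
  define g where "g n t = ennreal (b n t / t) * indicator {1 / (real n + 2)..1} t" for n t
  have [measurable]: "f \<in> borel_measurable borel" "\<And>n. g n \<in> borel_measurable borel"
    unfolding f_def g_def by measurable
  have "AE t in lborel. ennreal c * f t \<le> liminf (\<lambda>n. g n t)"
    using lim
  proof eventually_elim
    case (elim t)
    show ?case
    proof (cases "t \<in> S \<and> 0 < t \<and> t \<le> 1")
      case True
      then have "(\<lambda>n. ennreal (b n t / t)) \<longlonglongrightarrow> ennreal (c / t)"
        using elim by (intro tendsto_intros) auto
      moreover have "(\<lambda>n. 1 / (real n + 2)) \<longlonglongrightarrow> 0" by real_asymp
      then have "eventually (\<lambda>n. 1 / (real n + 2) < t) sequentially"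
        using True by (intro order_tendstoD) auto
      then have "eventually (\<lambda>n. ennreal (b n t / t) = g n t) sequentially"
      proof eventually_elim
        case (elim n)
        then show ?case using True by (simp add: g_def)
      qed
      ultimately have "(\<lambda>n. g n t) \<longlonglongrightarrow> ennreal (c / t)"
        by (rule Lim_transform_eventually)
      then have "liminf (\<lambda>n. g n t) = ennreal (c / t)"
        by (intro lim_imp_Liminf) auto
      then show ?thesis
        using True c by (simp add: f_def ennreal_mult[symmetric])
    qed (auto simp: f_def)
  qed
  then have "ennreal c * (\<integral>\<^sup>+ t. f t \<partial>lborel) \<le> (\<integral>\<^sup>+ t. liminf (\<lambda>n. g n t) \<partial>lborel)"
    by (subst nn_integral_cmult[symmetric]) (auto intro: nn_integral_mono_AE)
  also have "\<dots> \<le> liminf (\<lambda>n. \<integral>\<^sup>+ t. g n t \<partial>lborel)"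
    by (rule nn_integral_liminf) auto
  also have "\<dots> \<le> ennreal B"
    using Liminf_mono[of "\<lambda>n. \<integral>\<^sup>+ t. g n t \<partial>lborel" "\<lambda>_. ennreal B" sequentially] bound
    by (simp add: g_def Liminf_const)
  finally have "ennreal c * (\<integral>\<^sup>+ t. f t \<partial>lborel) < \<infinity>"
    by (rule le_less_trans) simp
  then show ?thesis
    using c by (auto simp: f_def ennreal_mult_less_top)
qed

lemma nn_integral_split_at_pole:
  fixes E :: "real set" and x :: real
  assumes [measurable]: "E \<in> sets borel"
  shows "(\<integral>\<^sup>+ t \<in> {x - 1..x + 1}. ennreal (indicator E t / \<bar>t - x\<bar>) \<partial>lborel) =
    (\<integral>\<^sup>+ t. ennreal (indicator {t. x + t \<in> E} t / t) * indicator {0<..1} t \<partial>lborel) +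
    (\<integral>\<^sup>+ t. ennreal (indicator {t. x - t \<in> E} t / t) * indicator {0<..1} t \<partial>lborel)"
proof -
  define p where "p t = ennreal (indicator E t / \<bar>t - x\<bar>)" for t
  have [measurable]: "p \<in> borel_measurable borel" unfolding p_def by measurable
  have "(\<integral>\<^sup>+ t. p t * indicator {x - 1..x + 1} t \<partial>lborel) =
      (\<integral>\<^sup>+ t. p t * indicator {x<..x + 1} t + p t * indicator {x - 1..<x} t \<partial>lborel)"
    by (intro nn_integral_cong) (auto simp: p_def split: split_indicator)
  also have "\<dots> = (\<integral>\<^sup>+ t. p t * indicator {x<..x + 1} t \<partial>lborel) + (\<integral>\<^sup>+ t. p t * indicator {x - 1..<x} t \<partial>lborel)"
    by (intro nn_integral_add) auto
  also have "(\<integral>\<^sup>+ t. p t * indicator {x<..x + 1} t \<partial>lborel) =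
      (\<integral>\<^sup>+ t. ennreal (indicator {t. x + t \<in> E} t / t) * indicator {0<..1} t \<partial>lborel)"
    by (subst nn_integral_real_affine[where c = 1 and t = x])
      (auto simp: p_def split: split_indicator intro!: nn_integral_cong)
  also have "(\<integral>\<^sup>+ t. p t * indicator {x - 1..<x} t \<partial>lborel) =
      (\<integral>\<^sup>+ t. ennreal (indicator {t. x - t \<in> E} t / t) * indicator {0<..1} t \<partial>lborel)"
    by (subst nn_integral_real_affine[where c = "-1" and t = x])
      (auto simp: p_def split: split_indicator intro!: nn_integral_cong)
  finally show ?thesis by (simp add: p_def)
qed

lemma AE_lborel_affine:
  fixes P :: "real \<Rightarrow> bool"
  assumes "AE t in lborel. P t" "c \<noteq> 0"
  shows "AE t in lborel. P (x + c * t)"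
proof -
  obtain N where N: "\<And>t. t \<in> space lborel - N \<Longrightarrow> P t" "N \<in> null_sets lborel"
    using AE_E3[OF assms(1)] by blast
  then have [measurable]: "N \<in> sets borel" by (auto simp: null_sets_def)
  have "AE t in lborel. x + c * t \<notin> N"
    by (rule AE_borel_affine[OF assms(2), where P = "\<lambda>t. t \<notin> N"]) (use AE_not_in[OF N(2)] in auto)
  then show ?thesis using N(1) by (auto elim!: eventually_mono)
qed

text \<open>
  The argument is taken of \<open>F + \<i>\<close> rather than \<open>F\<close>: adding \<open>\<i>\<close> preserves the real part and both estimates, and
  it keeps the boundary values away from \<open>0\<close>, where the argument would be discontinuous. So the
  argument tends to \<open>\<pi> / 2\<close> at almost every point of \<open>E\<close>, and half of the extremal argument
  is missing on \<open>E\<close> on both sides of \<open>x\<close>.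
\<close>
lemma reflectionless_atom_imp_finite:
  fixes E :: "real set" and x :: real
  assumes E [measurable]: "E \<in> sets borel" and \<mu>: "\<mu> \<in> reflectionless_measures E"
    and x: "emeasure \<mu> {x} \<noteq> 0"
  shows "(\<integral>\<^sup>+ t \<in> {x - 1..x + 1}. ennreal (indicator E t / \<bar>t - x\<bar>) \<partial>lborel) < \<infinity>"
proof -
  from \<mu> obtain a b where H: "Herglotz_measure \<mu>" and b: "b \<ge> 0"
    and F: "Herglotz_fun a b \<mu> \<in> reflectionless_class E"
    by (auto simp: reflectionless_measures_def)
  define F where "F = Herglotz_fun a b \<mu>"
  define m where "m = measure \<mu> {x}"
  have m: "m > 0"
    using x Herglotz_measure_atom_finite[OF H, of x]
    by (auto simp: m_def measure_def enn2real_positive_iff zero_less_iff_neq_zero)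
  obtain C where C: "C > 0" "\<And>z. Im z > 0 \<Longrightarrow> cmod (z - of_real x) \<le> 2 \<Longrightarrow> cmod (F z + \<i>) \<le> C / Im z"
    using Herglotz_fun_upper_bound[OF H b, of x a] unfolding F_def by blast
  have Fhol: "F holomorphic_on {z. Im z > 0}" and Fpos: "\<And>z. Im z > 0 \<Longrightarrow> Im (F z) > 0"
    using F by (auto simp: F_def reflectionless_class_def Herglotz_def upper_half_plane_def)
  define \<delta> where "\<delta> n = 1 / (real n + 2)" for n
  have \<delta>: "0 < \<delta> n" "\<delta> n < 1" for n by (auto simp: \<delta>_def)
  define A where "A n t = Arg (F (of_real t + \<i> * of_real (\<delta> n)) + \<i>)" for n t
  have A: "0 < A n t" "A n t < pi" for n t
    using Arg_lt_pi[of "F (of_real t + \<i> * of_real (\<delta> n)) + \<i>"] Fpos[of "of_real t + \<i> * of_real (\<delta> n)"] \<delta>[of n]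
    by (auto simp: A_def)
  have [measurable]: "A n \<in> borel_measurable borel" for n
    unfolding A_def
  proof (intro borel_measurable_continuous_onI continuous_intros
        continuous_on_compose2[OF holomorphic_on_imp_continuous_on[OF Fhol]])
    show "F (of_real t + \<i> * of_real (\<delta> n)) + \<i> \<notin> \<real>\<^sub>\<le>\<^sub>0" for t
      using Fpos[of "of_real t + \<i> * of_real (\<delta> n)"] \<delta>[of n] by (auto simp: complex_nonpos_Reals_iff)
  qed (use \<delta>[of n] in auto)
  define B where "B = pi * ln C - pi * ln (m / 4) + 8"
  have defic: "\<exists>I \<le> B. ((\<lambda>t. (pi - A n (x + t) + A n (x - t)) / t) has_integral I) {\<delta> n..1}" for n
    unfolding B_def A_def
  proof (rule argument_deficiency_bound[where G = "\<lambda>z. F z + \<i>"])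
    show "m * Im z / (cmod (z - of_real x))\<^sup>2 \<le> Im (F z + \<i>)" if "Im z > 0" for z
      using Herglotz_fun_Im_ge[OF H b that, of x a] by (simp add: F_def m_def)
  qed (use Fhol Fpos C m \<delta>[of n] in \<open>auto intro!: holomorphic_intros add_pos_pos\<close>)
  have le: "(\<integral>\<^sup>+ t. ennreal (f t / t) * indicator {\<delta> n..1} t \<partial>lborel) \<le> ennreal B"
    if "\<And>t. f t \<le> pi - A n (x + t) + A n (x - t)" for f n
  proof -
    obtain I where I: "I \<le> B" "((\<lambda>t. (pi - A n (x + t) + A n (x - t)) / t) has_integral I) {\<delta> n..1}"
      using defic by blast
    have "(\<integral>\<^sup>+ t. ennreal (f t / t) * indicator {\<delta> n..1} t \<partial>lborel) \<le>
        (\<integral>\<^sup>+ t. ennreal ((pi - A n (x + t) + A n (x - t)) / t) * indicator {\<delta> n..1} t \<partial>lborel)"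
      using that \<delta>[of n]
      by (intro nn_integral_mono) (auto intro!: ennreal_leI divide_right_mono split: split_indicator)
    also have "\<dots> = ennreal I"
      using \<delta>[of n] A(2)[of n] less_imp_le[OF A(1)[of n]] less_imp_le[OF A(2)[of n]]
      by (intro nn_integral_has_integral_lebesgue'[OF _ I(2)]) (auto intro!: divide_nonneg_nonneg add_nonneg_nonneg)
    finally show ?thesis using I(1) ennreal_leI order_trans by blast
  qed
  have "AE t in lborel. t \<in> E \<longrightarrow> (\<exists>w. ((\<lambda>y. F (of_real t + \<i> * of_real y)) \<longlongrightarrow> w) (at_right 0) \<and> Re w = 0)"
    using F by (simp add: F_def reflectionless_class_def)
  then have lim: "AE t in lborel. t \<in> E \<longrightarrow> (\<lambda>n. A n t) \<longlonglongrightarrow> pi / 2"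
  proof eventually_elim
    case (elim t)
    show ?case
    proof
      assume "t \<in> E"
      with elim obtain w where w: "((\<lambda>y. F (of_real t + \<i> * of_real y)) \<longlongrightarrow> w) (at_right 0)" "Re w = 0"
        by blast
      have "filterlim \<delta> (at_right 0) sequentially"
        unfolding \<delta>_def by real_asymp
      from filterlim_compose[OF w(1) this]
      have lim: "(\<lambda>n. F (of_real t + \<i> * of_real (\<delta> n))) \<longlonglongrightarrow> w" .
      have "Im w \<ge> 0"
        by (rule tendsto_lowerbound[OF tendsto_Im[OF lim]])
          (use \<delta> Fpos in \<open>auto intro!: always_eventually less_imp_le\<close>)
      have "(\<lambda>n. A n t) \<longlonglongrightarrow> Arg (w + \<i>)"
        unfolding A_def
        by (rule isCont_tendsto_compose[OF continuous_at_Arg tendsto_add[OF lim tendsto_const]])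
          (use w(2) \<open>Im w \<ge> 0\<close> in \<open>auto simp: complex_nonpos_Reals_iff\<close>)
      moreover have "w + \<i> = of_real (Im w + 1) * \<i>"
        using w(2) by (simp add: complex_eq_iff)
      then have "Arg (w + \<i>) = pi / 2"
        using \<open>Im w \<ge> 0\<close> Arg_times_of_real[of "Im w + 1" \<i>] by simp
      ultimately show "(\<lambda>n. A n t) \<longlonglongrightarrow> pi / 2" by simp
    qed
  qed
  have "(\<integral>\<^sup>+ t. ennreal (indicator {t. x + t \<in> E} t / t) * indicator {0<..1} t \<partial>lborel) < \<infinity>"
  proof (rule nn_integral_finite_by_Fatou[where b = "\<lambda>n t. pi - A n (x + t)" and c = "pi/2", OF _ _ le[unfolded \<delta>_def]])
    show "AE t in lborel. t \<in> {t. x + t \<in> E} \<longrightarrow> (\<lambda>n. pi - A n (x + t)) \<longlonglongrightarrow> pi / 2"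
      using AE_lborel_affine[OF lim zero_neq_one[symmetric], of x]
    proof eventually_elim
      case (elim t)
      then show ?case
        using tendsto_diff[of "\<lambda>_. pi" pi sequentially "\<lambda>n. A n (x + t)" "pi / 2"] by simp
    qed
  qed (use A in \<open>auto intro: less_imp_le\<close>)
  moreover have "(\<integral>\<^sup>+ t. ennreal (indicator {t. x - t \<in> E} t / t) * indicator {0<..1} t \<partial>lborel) < \<infinity>"
  proof (rule nn_integral_finite_by_Fatou[where b = "\<lambda>n t. A n (x - t)" and c = "pi/2", OF _ _ le[unfolded \<delta>_def]])
    show "AE t in lborel. t \<in> {t. x - t \<in> E} \<longrightarrow> (\<lambda>n. A n (x - t)) \<longlonglongrightarrow> pi / 2"
      using AE_lborel_affine[OF lim, of "-1" x] by simp
  qed (use A in \<open>auto intro: less_imp_le\<close>)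
  ultimately show ?thesis
    unfolding nn_integral_split_at_pole[OF E] by simp
qed

section \<open>Cauchy transforms of bounded densities\<close>

text \<open>
  The difference quotient of the kernel differs from its derivative by \<open>(w - z) / ((t - w) (t - z)\<^sup>2)\<close>, and this is
  \<open>O (\<bar>w - z\<bar>)\<close> uniformly in \<open>t\<close>, hence after integration against \<open>\<phi>\<close> as well.
\<close>
lemma Cauchy_transform_holomorphic:
  fixes \<phi> :: "real \<Rightarrow> real"
  assumes \<phi>: "integrable lborel \<phi>"
  shows "(\<lambda>z. LINT t|lborel. of_real (\<phi> t) / (of_real t - z)) holomorphic_on {z. Im z > 0}"
proof -
  have [measurable]: "\<phi> \<in> borel_measurable borel" using \<phi> by auto
  have low: "Im z \<le> cmod (complex_of_real t - z)" for t z by (rule Im_le_cmod_diff)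
  have int: "integrable lborel (\<lambda>t. complex_of_real (\<phi> t) / (of_real t - z) ^ k)" if "Im z > 0" for z k
  proof (rule Bochner_Integration.integrable_bound[of _ "\<lambda>t. \<bar>\<phi> t\<bar> * (1 / Im z ^ k)"])
    show "AE t in lborel. norm (of_real (\<phi> t) / (complex_of_real t - z) ^ k) \<le> norm (\<bar>\<phi> t\<bar> * (1 / Im z ^ k))"
    proof (rule AE_I2)
      fix t
      have "norm (of_real (\<phi> t) / (complex_of_real t - z) ^ k) \<le> \<bar>\<phi> t\<bar> / Im z ^ k"
        unfolding norm_divide norm_power norm_of_real
        using low[of z t] that by (intro divide_left_mono power_mono mult_pos_pos zero_less_power) auto
      then show "norm (of_real (\<phi> t) / (complex_of_real t - z) ^ k) \<le> norm (\<bar>\<phi> t\<bar> * (1 / Im z ^ k))"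
        using that by simp
    qed
  qed (use \<phi> in auto)
  have "((\<lambda>z. LINT t|lborel. of_real (\<phi> t) / (of_real t - z)) has_field_derivative (LINT t|lborel. complex_of_real (\<phi> t) / (of_real t - z)\<^sup>2)) (at z)"
    if z: "Im z > 0" for z :: complex
    unfolding has_field_derivative_iff
  proof (rule LIM_zero_cancel, rule tendsto_norm_zero_cancel)
    define N where "N = (LINT t|lborel. \<bar>\<phi> t\<bar>)"
    have "((\<lambda>w. cmod (w - z) * (N * (2 / Im z ^ 3))) \<longlongrightarrow> cmod (z - z) * (N * (2 / Im z ^ 3))) (at z)"
      by (intro tendsto_intros)
    then have lim: "((\<lambda>w. cmod (w - z) * (N * (2 / Im z ^ 3))) \<longlongrightarrow> 0) (at z)" by simp
    have "eventually (\<lambda>w. Im w > Im z / 2) (at z)"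
      by (rule order_tendstoD[OF tendsto_Im[OF tendsto_ident_at]]) (use z in auto)
    then have "eventually (\<lambda>w. norm (((LINT t|lborel. complex_of_real (\<phi> t) / (of_real t - w)) - (LINT t|lborel. complex_of_real (\<phi> t) / (of_real t - z))) / (w - z)
        - (LINT t|lborel. complex_of_real (\<phi> t) / (of_real t - z)\<^sup>2)) \<le> cmod (w - z) * (N * (2 / Im z ^ 3))) (at z)"
      using eventually_neq_at_within[of z z UNIV]
    proof eventually_elim
      case (elim w)
      have w: "Im w > 0" using elim z by simp
      have ne: "complex_of_real t - z \<noteq> 0" "complex_of_real t - w \<noteq> 0" "w - z \<noteq> 0" for t
        using z w elim by (auto simp: complex_eq_iff)
      have "((LINT t|lborel. complex_of_real (\<phi> t) / (of_real t - w)) - (LINT t|lborel. complex_of_real (\<phi> t) / (of_real t - z))) / (w - z)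
          - (LINT t|lborel. complex_of_real (\<phi> t) / (of_real t - z)\<^sup>2) =
          (LINT t|lborel. (of_real (\<phi> t) / (of_real t - w) - of_real (\<phi> t) / (of_real t - z)) / (w - z) - of_real (\<phi> t) / (of_real t - z)\<^sup>2)"
        using int[OF w, of 1] int[OF z, of 1] int[OF z, of 2] by simp
      also have "\<dots> = (LINT t|lborel. (w - z) * (of_real (\<phi> t) / ((of_real t - w) * (of_real t - z)\<^sup>2)))"
      proof (rule Bochner_Integration.integral_cong[OF refl])
        fix t
        have "(p / (T - w) - p / (T - z)) / (w - z) - p / (T - z)\<^sup>2 = (w - z) * (p / ((T - w) * (T - z)\<^sup>2))"
          if "T - z \<noteq> 0" "T - w \<noteq> 0" for p T
          using that ne(3) by (simp add: divide_simps power2_eq_square) (simp add: algebra_simps)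
        from this[OF ne(1,2)] show "(of_real (\<phi> t) / (of_real t - w) - of_real (\<phi> t) / (of_real t - z)) / (w - z) - of_real (\<phi> t) / (of_real t - z)\<^sup>2
            = (w - z) * (of_real (\<phi> t) / ((of_real t - w) * (of_real t - z)\<^sup>2))" .
      qed
      also have "\<dots> = (w - z) * (LINT t|lborel. complex_of_real (\<phi> t) / ((of_real t - w) * (of_real t - z)\<^sup>2))"
        by (rule Bochner_Integration.integral_mult_right_zero)
      also have "cmod \<dots> = cmod (w - z) * cmod (LINT t|lborel. complex_of_real (\<phi> t) / ((of_real t - w) * (of_real t - z)\<^sup>2))"
        by (rule norm_mult)
      also have "\<dots> \<le> cmod (w - z) * (LINT t|lborel. \<bar>\<phi> t\<bar> * (2 / Im z ^ 3))"
      proof (intro mult_left_mono)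
        have bd: "cmod (complex_of_real (\<phi> t) / ((of_real t - w) * (of_real t - z)\<^sup>2)) \<le> \<bar>\<phi> t\<bar> * (2 / Im z ^ 3)" for t
        proof -
          have "Im z ^ 3 / 2 = Im z / 2 * (Im z)\<^sup>2" by (simp add: power3_eq_cube power2_eq_square)
          also have "\<dots> \<le> cmod (of_real t - w) * (cmod (of_real t - z))\<^sup>2"
            using low[of z t] low[of w t] elim z by (intro mult_mono power_mono) auto
          finally have "\<bar>\<phi> t\<bar> / (cmod (of_real t - w) * (cmod (of_real t - z))\<^sup>2) \<le> \<bar>\<phi> t\<bar> / (Im z ^ 3 / 2)"
            using z ne by (intro divide_left_mono) auto
          then show ?thesis by (simp add: norm_divide norm_mult norm_power)
        qed
        show "cmod (LINT t|lborel. complex_of_real (\<phi> t) / ((of_real t - w) * (of_real t - z)\<^sup>2)) \<le> (LINT t|lborel. \<bar>\<phi> t\<bar> * (2 / Im z ^ 3))"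
        proof (rule Bochner_Integration.integral_norm_bound_integral[OF _ _ bd])
          show i: "integrable lborel (\<lambda>t. \<bar>\<phi> t\<bar> * (2 / Im z ^ 3))" using \<phi> by auto
          show "integrable lborel (\<lambda>t. complex_of_real (\<phi> t) / ((of_real t - w) * (of_real t - z)\<^sup>2))"
          proof (rule Bochner_Integration.integrable_bound[OF i])
            show "AE t in lborel. norm (complex_of_real (\<phi> t) / ((of_real t - w) * (of_real t - z)\<^sup>2))
                \<le> norm (\<bar>\<phi> t\<bar> * (2 / Im z ^ 3))"
              by (intro AE_I2 order_trans[OF bd]) (simp only: real_norm_def abs_ge_self)
          qed measurable
        qed
      qed auto
      finally show ?case by (simp add: N_def)
    qed
    then have "((\<lambda>w. norm (((LINT t|lborel. complex_of_real (\<phi> t) / (of_real t - w)) - (LINT t|lborel. complex_of_real (\<phi> t) / (of_real t - z))) / (w - z)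
        - (LINT t|lborel. complex_of_real (\<phi> t) / (of_real t - z)\<^sup>2))) \<longlongrightarrow> 0) (at z)"
      by (intro tendsto_sandwich[OF _ _ tendsto_const lim]) auto
    then show "((\<lambda>w. norm (((LINT t|lborel. complex_of_real (\<phi> t) / (of_real t - w)) - (LINT t|lborel. complex_of_real (\<phi> t) / (of_real t - z))) / (w - z)
        - (LINT t|lborel. complex_of_real (\<phi> t) / (of_real t - z)\<^sup>2))) \<longlongrightarrow> 0) (at z)" .
  qed
  then show ?thesis
    by (intro holomorphic_onI) (auto simp: field_differentiable_def intro: DERIV_subset)
qed

lemma Cauchy_kernel_integrable:
  fixes \<phi> :: "real \<Rightarrow> real"
  assumes \<phi>: "integrable lborel \<phi>" and z: "Im z > 0"
  shows "integrable lborel (\<lambda>t. complex_of_real (\<phi> t) / (of_real t - z))"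
proof (rule Bochner_Integration.integrable_bound[of _ "\<lambda>t. \<bar>\<phi> t\<bar> * (1 / Im z)"])
  show "AE t in lborel. norm (complex_of_real (\<phi> t) / (of_real t - z)) \<le> norm (\<bar>\<phi> t\<bar> * (1 / Im z))"
  proof (rule AE_I2)
    fix t
    have "norm (complex_of_real (\<phi> t) / (of_real t - z)) \<le> \<bar>\<phi> t\<bar> / Im z"
      unfolding norm_divide norm_of_real using Im_le_cmod_diff[of z t] z by (intro divide_left_mono mult_pos_pos) auto
    then show "norm (complex_of_real (\<phi> t) / (of_real t - z)) \<le> norm (\<bar>\<phi> t\<bar> * (1 / Im z))"
      using z by simp
  qed
qed (use \<phi> in auto)

lemma Im_Cauchy_kernel:
  "Im (complex_of_real p / (of_real t - z)) = p * (Im z / ((t - Re z)\<^sup>2 + (Im z)\<^sup>2))"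
  by (simp add: Im_divide)

lemma Re_Cauchy_kernel:
  "Re (complex_of_real p / (of_real t - z)) = p * ((t - Re z) / ((t - Re z)\<^sup>2 + (Im z)\<^sup>2))"
  by (simp add: Re_divide)

text \<open>
  The imaginary part is a Poisson integral of \<open>\<phi>\<close>. The Poisson kernel has total mass \<open>\<pi>\<close> on the line, hence
  strictly less on a bounded interval, and this strictness is what makes \<open>\<i> exp h\<close> a map into the open half plane.
\<close>
lemma Cauchy_transform_Im_bound:
  fixes \<phi> :: "real \<Rightarrow> real"
  assumes \<phi>: "integrable lborel \<phi>" and bound: "\<And>t. \<bar>\<phi> t\<bar> \<le> indicator {a..b} t / 2" and z: "Im z > 0" and ab: "a \<le> b"
  shows "\<bar>Im (LINT t|lborel. complex_of_real (\<phi> t) / (of_real t - z))\<bar> < pi / 2"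
proof -
  define u y where "u = Re z" and "y = Im z"
  have y: "y > 0" using z by (simp add: y_def)
  have pos: "(t - u)\<^sup>2 + y\<^sup>2 > 0" for t using y by (simp add: add_nonneg_pos)
  have deriv: "((\<lambda>t. arctan ((t - u) / y)) has_real_derivative y / ((t - u)\<^sup>2 + y\<^sup>2)) (at t)" for t
  proof -
    have eq: "y / ((t - u)\<^sup>2 + y\<^sup>2) = inverse (1 + ((t - u) / y)\<^sup>2) * (1 / y)"
      using y pos[of t] by (simp add: power_divide divide_simps) (simp add: power2_eq_square algebra_simps)
    show ?thesis unfolding eq using y by (auto intro!: derivative_eq_intros)
  qed
  have P: "has_bochner_integral lborel (\<lambda>t. y / ((t - u)\<^sup>2 + y\<^sup>2) * indicator {a..b} t) (arctan ((b - u) / y) - arctan ((a - u) / y))"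
    by (rule has_bochner_integral_FTC_Icc_real[OF ab deriv]) (use pos in \<open>auto intro!: continuous_intros simp: less_imp_neq[THEN not_sym]\<close>)
  have "\<bar>Im (LINT t|lborel. complex_of_real (\<phi> t) / (of_real t - z))\<bar> =
      norm (LINT t|lborel. \<phi> t * (y / ((t - u)\<^sup>2 + y\<^sup>2)))"
    using integral_Im[OF Cauchy_kernel_integrable[OF \<phi> z]] by (simp add: Im_Cauchy_kernel u_def y_def)
  also have "\<dots> \<le> (LINT t|lborel. y / ((t - u)\<^sup>2 + y\<^sup>2) * indicator {a..b} t * (1 / 2))"
  proof (rule Bochner_Integration.integral_norm_bound_integral)
    show "integrable lborel (\<lambda>t. \<phi> t * (y / ((t - u)\<^sup>2 + y\<^sup>2)))"
      using integrable_Im[OF Cauchy_kernel_integrable[OF \<phi> z]] by (simp add: Im_Cauchy_kernel u_def y_def)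
    show "integrable lborel (\<lambda>t. y / ((t - u)\<^sup>2 + y\<^sup>2) * indicator {a..b} t * (1 / 2))"
      using P by (intro integrable_mult_left) (auto simp: has_bochner_integral_iff)
    fix t
    have "\<bar>\<phi> t * (y / ((t - u)\<^sup>2 + y\<^sup>2))\<bar> = \<bar>\<phi> t\<bar> * (y / ((t - u)\<^sup>2 + y\<^sup>2))"
      using y pos[of t] by (simp add: abs_mult)
    also have "\<dots> \<le> (indicator {a..b} t / 2) * (y / ((t - u)\<^sup>2 + y\<^sup>2))"
      using y pos[of t] by (intro mult_right_mono bound) (auto intro!: divide_nonneg_nonneg)
    finally show "norm (\<phi> t * (y / ((t - u)\<^sup>2 + y\<^sup>2))) \<le> y / ((t - u)\<^sup>2 + y\<^sup>2) * indicator {a..b} t * (1 / 2)"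
      by (simp add: mult_ac)
  qed
  also have "\<dots> = (arctan ((b - u) / y) - arctan ((a - u) / y)) / 2"
    unfolding Bochner_Integration.integral_mult_left_zero has_bochner_integral_integral_eq[OF P] by simp
  also have "\<dots> < pi / 2"
    using arctan_ubound[of "(b - u) / y"] arctan_lbound[of "(a - u) / y"] by simp
  finally show ?thesis .
qed

lemma Cauchy_transform_boundary_value:
  fixes \<phi> :: "real \<Rightarrow> real"
  assumes \<phi>: "integrable lborel \<phi>" and K: "closed K" "\<And>t. t \<notin> K \<Longrightarrow> \<phi> t = 0" and x: "x \<notin> K"
  shows "((\<lambda>y. LINT t|lborel. complex_of_real (\<phi> t) / (of_real t - (of_real x + \<i> * of_real y)))
      \<longlongrightarrow> of_real (LINT t|lborel. \<phi> t / (t - x))) (at_right 0)"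
  unfolding tendsto_at_iff_sequentially
proof (intro allI impI)
  fix Y :: "nat \<Rightarrow> real" assume Y: "\<forall>i. Y i \<in> {0<..} - {0}" "Y \<longlonglongrightarrow> 0"
  have [measurable]: "\<phi> \<in> borel_measurable borel" using \<phi> by auto
  obtain d where d: "d > 0" "ball x d \<subseteq> - K"
    using K(1) x open_contains_ball[of "- K"] by (auto simp: open_Compl)
  have far: "d \<le> \<bar>t - x\<bar>" if "\<phi> t \<noteq> 0" for t
    using that d K(2)[of t] by (auto simp: subset_iff dist_real_def not_less[symmetric] abs_minus_commute)
  have "(\<lambda>n. LINT t|lborel. complex_of_real (\<phi> t) / (of_real t - (of_real x + \<i> * of_real (Y n))))
      \<longlonglongrightarrow> (LINT t|lborel. complex_of_real (\<phi> t / (t - x)))"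
  proof (rule integral_dominated_convergence)
    show "integrable lborel (\<lambda>t. \<bar>\<phi> t\<bar> * (1 / d))" using \<phi> by auto
    show "AE t in lborel. (\<lambda>n. complex_of_real (\<phi> t) / (of_real t - (of_real x + \<i> * of_real (Y n)))) \<longlonglongrightarrow> of_real (\<phi> t / (t - x))"
    proof (rule AE_I2)
      fix t
      show "(\<lambda>n. complex_of_real (\<phi> t) / (of_real t - (of_real x + \<i> * of_real (Y n)))) \<longlonglongrightarrow> of_real (\<phi> t / (t - x))"
      proof (cases "\<phi> t = 0")
        case False
        then have "t \<noteq> x" using far d by fastforce
        then have "(\<lambda>n. complex_of_real (\<phi> t) / (of_real t - (of_real x + \<i> * of_real (Y n))))
            \<longlonglongrightarrow> of_real (\<phi> t) / (of_real t - (of_real x + \<i> * of_real 0))"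
          by (intro tendsto_intros Y) auto
        then show ?thesis by simp
      qed simp
    qed
    show "AE t in lborel. norm (complex_of_real (\<phi> t) / (of_real t - (of_real x + \<i> * of_real (Y n)))) \<le> \<bar>\<phi> t\<bar> * (1 / d)" for n
    proof (rule AE_I2)
      fix t
      have "d \<le> cmod (of_real t - (of_real x + \<i> * of_real (Y n)))" if "\<phi> t \<noteq> 0"
        using far[OF that] abs_Re_le_cmod[of "of_real t - (of_real x + \<i> * of_real (Y n))"] by simp
      then show "norm (complex_of_real (\<phi> t) / (of_real t - (of_real x + \<i> * of_real (Y n)))) \<le> \<bar>\<phi> t\<bar> * (1 / d)"
        using d by (cases "\<phi> t = 0") (auto simp: norm_divide intro!: divide_left_mono mult_pos_pos)
    qed
  qed auto
  then show "((\<lambda>y. LINT t|lborel. complex_of_real (\<phi> t) / (of_real t - (of_real x + \<i> * of_real y))) \<circ> Y)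
      \<longlonglongrightarrow> of_real (LINT t|lborel. \<phi> t / (t - x))"
    by (simp add: o_def del: of_real_divide)
qed

text \<open>
  This is the maximal growth \<open>2 ln (1 / y)\<close>, up to a bounded error, of the real part of a Cauchy transform
  at \<open>x + \<i>y\<close>; it belongs to the density \<open>sgn (t - x)\<close> on the whole interval.
\<close>
lemma integral_abs_conjugate_Poisson:
  fixes x y :: real
  assumes y: "y > 0"
  shows "has_bochner_integral lborel (\<lambda>t. \<bar>t - x\<bar> / ((t - x)\<^sup>2 + y\<^sup>2) * indicator {x - 1..x + 1} t) (ln ((1 + y\<^sup>2) / y\<^sup>2))"
proof -
  have pos: "(t - x)\<^sup>2 + y\<^sup>2 > 0" for t using y by (simp add: add_nonneg_pos)
  have deriv: "((\<lambda>t. ln ((t - x)\<^sup>2 + y\<^sup>2) / 2) has_real_derivative (t - x) / ((t - x)\<^sup>2 + y\<^sup>2)) (at t)" for t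
  proof -
    have "((\<lambda>t. ln ((t - x)\<^sup>2 + y\<^sup>2)) has_real_derivative 2 * ((t - x) / ((t - x)\<^sup>2 + y\<^sup>2))) (at t)"
      using pos[of t] by (auto intro!: derivative_eq_intros)
    then show ?thesis
      by (rule DERIV_cong[OF DERIV_cdivide[of _ _ _ _ 2] nonzero_mult_div_cancel_left]) simp
  qed
  have cont: "isCont (\<lambda>t. (t - x) / ((t - x)\<^sup>2 + y\<^sup>2)) t" for t
    using pos[of t] by (auto intro!: continuous_intros)
  have neg: "- ((t - x) / D) = (x - t) / D" for t D
    by (metis minus_diff_eq minus_divide_left)
  have r: "has_bochner_integral lborel (\<lambda>t. (t - x) / ((t - x)\<^sup>2 + y\<^sup>2) * indicator {x..x + 1} t)
      (ln ((x + 1 - x)\<^sup>2 + y\<^sup>2) / 2 - ln ((x - x)\<^sup>2 + y\<^sup>2) / 2)"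
    by (rule has_bochner_integral_FTC_Icc_real[OF _ deriv cont]) auto
  have l: "has_bochner_integral lborel (\<lambda>t. (t - x) / ((t - x)\<^sup>2 + y\<^sup>2) * indicator {x - 1..x} t)
      (ln ((x - x)\<^sup>2 + y\<^sup>2) / 2 - ln ((x - 1 - x)\<^sup>2 + y\<^sup>2) / 2)"
    by (rule has_bochner_integral_FTC_Icc_real[OF _ deriv cont]) auto
  have "has_bochner_integral lborel (\<lambda>t. (t - x) / ((t - x)\<^sup>2 + y\<^sup>2) * indicator {x..x + 1} t - (t - x) / ((t - x)\<^sup>2 + y\<^sup>2) * indicator {x - 1..x} t)
      (ln (1 + y\<^sup>2) - ln (y\<^sup>2))"
    using has_bochner_integral_diff[OF r l] by simp
  moreover have "(\<lambda>t. (t - x) / ((t - x)\<^sup>2 + y\<^sup>2) * indicator {x..x + 1} t - (t - x) / ((t - x)\<^sup>2 + y\<^sup>2) * indicator {x - 1..x} t)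
      = (\<lambda>t. \<bar>t - x\<bar> / ((t - x)\<^sup>2 + y\<^sup>2) * indicator {x - 1..x + 1} t)"
    by (auto simp: fun_eq_iff neg split: split_indicator)
  moreover have "1 + y\<^sup>2 \<noteq> 0" using pos[of "x + 1"] by simp
  ultimately show ?thesis using y by (simp add: ln_div)
qed

text \<open>
  Removing the points outside \<open>K\<close> from the extremal density on \<open>[x - 1, x + 1]\<close> costs no more than the integral of \<open>1 / \<bar>t - x\<bar>\<close>
  over the removed set, uniformly in \<open>y\<close>.
\<close>
lemma Cauchy_transform_Re_ge:
  fixes x :: real and K :: "real set"
  assumes K [measurable]: "K \<in> sets borel" "K \<subseteq> {x - 1..x + 1}"
    and fin: "integrable lborel (\<lambda>t. indicator ({x - 1..x + 1} - K) t / \<bar>t - x\<bar>)" and y: "y > 0"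
  shows "Re (LINT t|lborel. complex_of_real (indicator K t * sgn (t - x) / 2) / (of_real t - (of_real x + \<i> * of_real y)))
    \<ge> - ln y - (LINT t|lborel. indicator ({x - 1..x + 1} - K) t / \<bar>t - x\<bar>) / 2"
proof -
  define J where "J = (LINT t|lborel. indicator ({x - 1..x + 1} - K) t / \<bar>t - x\<bar>)"
  define q where "q t = \<bar>t - x\<bar> / ((t - x)\<^sup>2 + y\<^sup>2)" for t
  have [measurable]: "q \<in> borel_measurable borel" unfolding q_def by measurable
  have q: "q t \<ge> 0" "q t \<le> 1 / \<bar>t - x\<bar>" for t
  proof -
    show "q t \<ge> 0" by (simp add: q_def)
    show "q t \<le> 1 / \<bar>t - x\<bar>"
    proof (cases "t = x")
      case False
      then have "\<bar>t - x\<bar> / ((t - x)\<^sup>2 + y\<^sup>2) \<le> \<bar>t - x\<bar> / (t - x)\<^sup>2"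
        by (intro divide_left_mono mult_pos_pos add_pos_nonneg) auto
      also have "\<bar>t - x\<bar> / (t - x)\<^sup>2 = \<bar>t - x\<bar> / (\<bar>t - x\<bar> * \<bar>t - x\<bar>)" by (simp add: power2_eq_square)
      also have "\<dots> = 1 / \<bar>t - x\<bar>"
        using False by (simp only: nonzero_divide_mult_cancel_right abs_eq_0 right_minus_eq not_False_eq_True)
      finally show ?thesis by (simp add: q_def)
    qed (simp add: q_def)
  qed
  note P = integral_abs_conjugate_Poisson[OF y, of x, folded q_def]
  have int\<phi>: "integrable lborel (\<lambda>t. indicator K t * sgn (t - x) / 2)"
  proof (rule Bochner_Integration.integrable_bound[of _ "indicator {x - 1..x + 1}"])
    show "integrable lborel (indicator {x - 1..x + 1} :: real \<Rightarrow> real)" by (intro integrable_real_indicator) auto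
  qed (use K(2) in \<open>auto simp: sgn_if subset_iff split: split_indicator intro!: AE_I2\<close>)
  have "Re (LINT t|lborel. complex_of_real (indicator K t * sgn (t - x) / 2) / (of_real t - (of_real x + \<i> * of_real y)))
      = (LINT t|lborel. (q t * indicator {x - 1..x + 1} t - q t * indicator ({x - 1..x + 1} - K) t) / 2)"
  proof -
    have "Re (complex_of_real (indicator K t * sgn (t - x) / 2) / (of_real t - (of_real x + \<i> * of_real y)))
        = (q t * indicator {x - 1..x + 1} t - q t * indicator ({x - 1..x + 1} - K) t) / 2" for t
    proof -
      have "Re (complex_of_real (indicator K t * sgn (t - x) / 2) / (of_real t - (of_real x + \<i> * of_real y)))
          = indicator K t * q t / 2"
        unfolding Re_Cauchy_kernel by (simp add: q_def abs_sgn mult_ac)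
      then show ?thesis using K(2) by (auto split: split_indicator)
    qed
    note pointwise = this
    have "Im (of_real x + \<i> * of_real y) > 0" using y by simp
    note Re = integral_Re[OF Cauchy_kernel_integrable[OF int\<phi> this], symmetric]
    show ?thesis unfolding Re by (intro Bochner_Integration.integral_cong refl pointwise)
  qed
  also have "\<dots> = (ln ((1 + y\<^sup>2) / y\<^sup>2) - (LINT t|lborel. q t * indicator ({x - 1..x + 1} - K) t)) / 2"
  proof -
    have "integrable lborel (\<lambda>t. q t * indicator {x - 1..x + 1} t)" using P by (simp add: has_bochner_integral_iff)
    moreover from this have "integrable lborel (\<lambda>t. q t * indicator ({x - 1..x + 1} - K) t)"
      by (rule Bochner_Integration.integrable_bound) (use q in \<open>auto split: split_indicator\<close>)
    ultimately show ?thesis using P by (simp add: has_bochner_integral_iff)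
  qed
  also have "\<dots> \<ge> (ln (1 / y\<^sup>2) - J) / 2"
  proof -
    have "(LINT t|lborel. q t * indicator ({x - 1..x + 1} - K) t) \<le> J"
      unfolding J_def
      by (rule integral_mono'[OF fin]) (use q in \<open>auto split: split_indicator\<close>)
    moreover have "ln (1 / y\<^sup>2) \<le> ln ((1 + y\<^sup>2) / y\<^sup>2)"
      using y by (intro ln_mono divide_right_mono) (auto intro!: divide_pos_pos add_pos_nonneg)
    ultimately show ?thesis by (intro divide_right_mono diff_mono) auto
  qed
  also have "(ln (1 / y\<^sup>2) - J) / 2 = - ln y - J / 2" using y by (simp add: ln_div ln_realpow)
  finally show ?thesis by (simp add: J_def)
qed

section \<open>A reflectionless function with an atom\<close>

text \<open>
  The measure \<open>dt / \<bar>t - x\<bar>\<close> is infinite near \<open>x\<close>, so its outer regularity is assembled from the sets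
  \<open>\<bar>t - x\<bar> > 1 / (n + 1)\<close>, on which the density is at most \<open>n + 1\<close>: there the excess of the cover may be
  \<open>2\<^sup>-\<^sup>n / (n + 1)\<close> in Lebesgue measure.
\<close>
lemma open_cover_finite_integral:
  fixes E :: "real set" and x :: real
  assumes E [measurable]: "E \<in> sets borel"
    and fin: "(\<integral>\<^sup>+ t \<in> {x - 1..x + 1}. ennreal (indicator E t / \<bar>t - x\<bar>) \<partial>lborel) < \<infinity>"
  obtains U where "open U" "E - {x} \<subseteq> U"
    "(\<integral>\<^sup>+ t \<in> {x - 1..x + 1}. ennreal (indicator U t / \<bar>t - x\<bar>) \<partial>lborel) < \<infinity>"
proof -
  define B where "B n = {t. \<bar>t - x\<bar> > 1 / (real n + 1)}" for n
  have openB: "open (B n)" for n unfolding B_def by (intro open_Collect_less continuous_intros)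
  have [measurable]: "B n \<in> sets borel" for n using openB by auto
  have "\<exists>V. open V \<and> E \<inter> B n \<subseteq> V \<and> emeasure lebesgue (V - E \<inter> B n) < ennreal ((1/2) ^ n / (real n + 1))" for n
  proof -
    have "E \<inter> B n \<in> sets lebesgue" by (rule sets_completionI_sets) auto
    from sets_lebesgue_outer_open[OF this, of "(1/2) ^ n / (real n + 1)"] show ?thesis by (metis divide_pos_pos of_nat_0_le_iff add_nonneg_pos zero_less_one zero_less_power half_gt_zero)
  qed
  then obtain V where V: "\<And>n. open (V n)" "\<And>n. E \<inter> B n \<subseteq> V n"
    "\<And>n. emeasure lebesgue (V n - E \<inter> B n) < ennreal ((1/2) ^ n / (real n + 1))" by metis
  have [measurable]: "V n \<in> sets borel" for n using V(1) by auto
  define U where "U = (\<Union>n. V n \<inter> B n)"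
  have "open U" unfolding U_def using V(1) openB by auto
  have [measurable]: "U \<in> sets borel" unfolding U_def by measurable
  define W where "W n = V n \<inter> B n - E" for n
  have [measurable]: "W n \<in> sets borel" for n unfolding W_def by measurable
  have W: "ennreal (real n + 1) * emeasure lborel (W n) \<le> ennreal ((1/2) ^ n)" for n
  proof -
    have "emeasure lborel (W n) \<le> emeasure lborel (V n - E \<inter> B n)" by (intro emeasure_mono) (auto simp: W_def)
    also have "\<dots> = emeasure lebesgue (V n - E \<inter> B n)" by simp
    also have "\<dots> \<le> ennreal ((1/2) ^ n / (real n + 1))" using V(3)[of n] by (rule less_imp_le)
    finally have "ennreal (real n + 1) * emeasure lborel (W n) \<le> ennreal (real n + 1) * ennreal ((1/2) ^ n / (real n + 1))"
      by (intro mult_left_mono) auto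
    also have "\<dots> = ennreal ((1/2) ^ n)" by (subst ennreal_mult[symmetric]) auto
    finally show ?thesis .
  qed
  have "E - {x} \<subseteq> U"
  proof
    fix t assume t: "t \<in> E - {x}"
    then obtain n where "inverse (real (Suc n)) < \<bar>t - x\<bar>" using reals_Archimedean[of "\<bar>t - x\<bar>"] by auto
    then have "t \<in> B n" by (simp add: B_def inverse_eq_divide add.commute)
    then show "t \<in> U" using t V(2)[of n] by (auto simp: U_def)
  qed
  moreover have "(\<integral>\<^sup>+ t \<in> {x - 1..x + 1}. ennreal (indicator U t / \<bar>t - x\<bar>) \<partial>lborel) < \<infinity>"
  proof -
    have "(\<integral>\<^sup>+ t \<in> {x - 1..x + 1}. ennreal (indicator U t / \<bar>t - x\<bar>) \<partial>lborel) \<le>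
      (\<integral>\<^sup>+ t. ennreal (indicator E t / \<bar>t - x\<bar>) * indicator {x - 1..x + 1} t + (\<Sum>n. ennreal (real n + 1) * indicator (W n) t) \<partial>lborel)"
    proof (rule nn_integral_mono)
      fix t
      show "ennreal (indicator U t / \<bar>t - x\<bar>) * indicator {x - 1..x + 1} t \<le>
        ennreal (indicator E t / \<bar>t - x\<bar>) * indicator {x - 1..x + 1} t + (\<Sum>n. ennreal (real n + 1) * indicator (W n) t)"
      proof (cases "t \<in> U - E")
        case True
        then obtain n where n: "t \<in> W n" by (auto simp: U_def W_def)
        then have "1 / (real n + 1) < \<bar>t - x\<bar>" by (simp add: W_def B_def)
        then have "1 / \<bar>t - x\<bar> \<le> real n + 1"
          by (smt (verit) divide_less_eq_1_pos divide_le_eq mult.commute pos_divide_less_eq of_nat_0_le_iff)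
        then have "ennreal (indicator U t / \<bar>t - x\<bar>) * indicator {x - 1..x + 1} t \<le> ennreal (real n + 1) * indicator (W n) t"
          using True n by (auto intro!: ennreal_leI simp del: ennreal_plus split: split_indicator)
        also have "\<dots> \<le> (\<Sum>n. ennreal (real n + 1) * indicator (W n) t)"
        proof -
          define g where "g n = ennreal (real n + 1) * indicator (W n) t" for n
          have "g n \<le> (\<Sum>n. g n)" using sum_le_suminf[of g "{n}"] by simp
          then show ?thesis by (simp only: g_def)
        qed
        finally show ?thesis by (simp add: add_increasing)
      next
        case False
        then have "ennreal (indicator U t / \<bar>t - x\<bar>) \<le> ennreal (indicator E t / \<bar>t - x\<bar>)"
          by (intro ennreal_leI divide_right_mono) (auto split: split_indicator)
        then show ?thesis by (intro add_increasing2 mult_right_mono) auto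
      qed
    qed
    also have "\<dots> = (\<integral>\<^sup>+ t \<in> {x - 1..x + 1}. ennreal (indicator E t / \<bar>t - x\<bar>) \<partial>lborel) +
        (\<integral>\<^sup>+ t. (\<Sum>n. ennreal (real n + 1) * indicator (W n) t) \<partial>lborel)"
      by (intro nn_integral_add) auto
    also have "(\<integral>\<^sup>+ t. (\<Sum>n. ennreal (real n + 1) * indicator (W n) t) \<partial>lborel) = (\<Sum>n. ennreal (real n + 1) * emeasure lborel (W n))"
      by (subst nn_integral_suminf) (auto simp: nn_integral_cmult_indicator)
    also have "(\<integral>\<^sup>+ t \<in> {x - 1..x + 1}. ennreal (indicator E t / \<bar>t - x\<bar>) \<partial>lborel) + \<dots> < \<infinity>"
    proof -
      have "(\<Sum>n. ennreal (real n + 1) * emeasure lborel (W n)) \<le> (\<Sum>n. ennreal ((1/2) ^ n))"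
        by (intro suminf_le W) auto
      also have "\<dots> < \<infinity>"
      proof -
        have "(\<Sum>n. ennreal ((1/2) ^ n)) \<noteq> top"
          by (rule ennreal_suminf_neq_top) (auto intro: summable_geometric)
        then show ?thesis by (simp only: infinity_ennreal_def less_top)
      qed
      finally show ?thesis using fin by simp
    qed
    finally show ?thesis .
  qed
  ultimately show ?thesis using \<open>open U\<close> that by blast
qed

text \<open>
  With \<open>K\<close> the part of \<open>[x - 1, x + 1]\<close> outside an open cover of \<open>E - {x}\<close>, the function \<open>F = \<i> exp h\<close> has argument
  \<open>\<pi> / 2\<close> off \<open>K\<close> and the extremal argument almost everywhere on \<open>K\<close>. Since \<open>h\<close> is real on the
  complement of \<open>K\<close>, \<open>F\<close> is purely imaginary at every point of \<open>E\<close> other than \<open>x\<close>.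
\<close>
lemma finite_imp_reflectionless_atom:
  fixes E :: "real set" and x :: real
  assumes E: "E \<in> sets borel"
    and fin: "(\<integral>\<^sup>+ t \<in> {x - 1..x + 1}. ennreal (indicator E t / \<bar>t - x\<bar>) \<partial>lborel) < \<infinity>"
  shows "\<exists>\<mu> \<in> reflectionless_measures E. emeasure \<mu> {x} \<noteq> 0"
proof -
  obtain U where U: "open U" "E - {x} \<subseteq> U"
    "(\<integral>\<^sup>+ t \<in> {x - 1..x + 1}. ennreal (indicator U t / \<bar>t - x\<bar>) \<partial>lborel) < \<infinity>"
    using open_cover_finite_integral[OF E fin] by blast
  define K where "K = {x - 1..x + 1} - U"
  have K: "closed K" "K \<subseteq> {x - 1..x + 1}" "K \<in> sets borel"
    using U(1) by (auto simp: K_def intro!: closed_Diff)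
  note [measurable] = K(3)
  define \<phi> where "\<phi> t = indicator K t * sgn (t - x) / 2" for t
  have [measurable]: "\<phi> \<in> borel_measurable borel" unfolding \<phi>_def by measurable
  have \<phi>_bound: "\<bar>\<phi> t\<bar> \<le> indicator {x - 1..x + 1} t / 2" for t
    using K(2) by (auto simp: \<phi>_def sgn_if split: split_indicator)
  have int\<phi>: "integrable lborel \<phi>"
  proof (rule Bochner_Integration.integrable_bound[of _ "\<lambda>t. indicator {x - 1..x + 1} t / 2 :: real"])
    show "integrable lborel (\<lambda>t. indicator {x - 1..x + 1} t / 2 :: real)"
      by (intro integrable_divide_zero integrable_real_indicator) auto
    show "AE t in lborel. norm (\<phi> t) \<le> norm (indicator {x - 1..x + 1} t / 2 :: real)"
      using \<phi>_bound by (auto intro!: AE_I2 order_trans[OF \<phi>_bound])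
  qed simp
  have rest: "integrable lborel (\<lambda>t. indicator ({x - 1..x + 1} - K) t / \<bar>t - x\<bar>)"
  proof (rule integrableI_nonneg)
    have "(\<integral>\<^sup>+ t. ennreal (indicator ({x - 1..x + 1} - K) t / \<bar>t - x\<bar>) \<partial>lborel) =
        (\<integral>\<^sup>+ t \<in> {x - 1..x + 1}. ennreal (indicator U t / \<bar>t - x\<bar>) \<partial>lborel)"
    proof (rule nn_integral_cong)
      fix t
      show "ennreal (indicator ({x - 1..x + 1} - K) t / \<bar>t - x\<bar>) =
          ennreal (indicator U t / \<bar>t - x\<bar>) * indicator {x - 1..x + 1} t"
        by (cases "t \<in> {x - 1..x + 1}"; cases "t \<in> U") (auto simp: K_def)
    qed
    then show "(\<integral>\<^sup>+ t. ennreal (indicator ({x - 1..x + 1} - K) t / \<bar>t - x\<bar>) \<partial>lborel) < \<infinity>"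
      using U(3) by simp
  qed auto
  define J where "J = (LINT t|lborel. indicator ({x - 1..x + 1} - K) t / \<bar>t - x\<bar>)"
  define h where "h z = (LINT t|lborel. complex_of_real (\<phi> t) / (of_real t - z))" for z
  define F where "F z = \<i> * exp (h z)" for z
  have hol: "F holomorphic_on {z. Im z > 0}"
    unfolding F_def h_def by (intro holomorphic_intros Cauchy_transform_holomorphic int\<phi>)
  have ImF: "Im (F z) > 0" if "Im z > 0" for z
  proof -
    have "\<bar>Im (h z)\<bar> < pi / 2"
      unfolding h_def by (rule Cauchy_transform_Im_bound[OF int\<phi> \<phi>_bound that]) simp
    then have "cos (Im (h z)) > 0" by (intro cos_gt_zero_pi) auto
    then show ?thesis by (simp add: F_def Re_exp)
  qed
  have "Herglotz F" using hol ImF by (auto simp: Herglotz_def upper_half_plane_def)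
  then obtain a b \<mu> where \<mu>: "b \<ge> 0" "Herglotz_measure \<mu>" and rep: "\<And>z. Im z > 0 \<Longrightarrow> F z = Herglotz_fun a b \<mu> z"
    by (rule Herglotz_representation) blast
  have boundary: "\<exists>w. ((\<lambda>y. Herglotz_fun a b \<mu> (of_real t + \<i> * of_real y)) \<longlongrightarrow> w) (at_right 0) \<and> Re w = 0"
    if "t \<in> E" "t \<noteq> x" for t
  proof -
    have "t \<notin> K" using that U(2) by (auto simp: K_def)
    define r where "r = (LINT s|lborel. \<phi> s / (s - t))"
    have "((\<lambda>y. h (of_real t + \<i> * of_real y)) \<longlongrightarrow> of_real r) (at_right 0)"
      unfolding h_def r_def
      by (rule Cauchy_transform_boundary_value[OF int\<phi> K(1) _ \<open>t \<notin> K\<close>]) (simp add: \<phi>_def)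
    then have "((\<lambda>y. F (of_real t + \<i> * of_real y)) \<longlongrightarrow> \<i> * exp (of_real r)) (at_right 0)"
      unfolding F_def by (intro tendsto_intros)
    moreover have "eventually (\<lambda>y. F (of_real t + \<i> * of_real y) = Herglotz_fun a b \<mu> (of_real t + \<i> * of_real y)) (at_right 0)"
      using eventually_at_right_less[of "0 :: real"] by eventually_elim (simp add: rep)
    ultimately have "((\<lambda>y. Herglotz_fun a b \<mu> (of_real t + \<i> * of_real y)) \<longlongrightarrow> \<i> * exp (of_real r)) (at_right 0)"
      by (rule Lim_transform_eventually)
    then show ?thesis by (intro exI[of _ "\<i> * exp (of_real r)"]) (simp add: Im_exp)
  qed
  have "Herglotz_fun a b \<mu> \<in> reflectionless_class E"
  proof -
    have "Herglotz_fun a b \<mu> holomorphic_on {z. Im z > 0}"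
      by (rule holomorphic_transform[OF hol]) (simp add: rep)
    then have "Herglotz (Herglotz_fun a b \<mu>)"
      using ImF by (auto simp: Herglotz_def upper_half_plane_def rep)
    moreover have "AE t in lborel. t \<in> E \<longrightarrow>
        (\<exists>w. ((\<lambda>y. Herglotz_fun a b \<mu> (of_real t + \<i> * of_real y)) \<longlongrightarrow> w) (at_right 0) \<and> Re w = 0)"
      using AE_lborel_singleton[of x] by eventually_elim (use boundary in blast)
    ultimately show ?thesis by (simp add: reflectionless_class_def)
  qed
  then have "\<mu> \<in> reflectionless_measures E" using \<mu> by (auto simp: reflectionless_measures_def)
  moreover have "emeasure \<mu> {x} \<noteq> 0"
  proof
    assume zero: "emeasure \<mu> {x} = 0"
    define y where "y n = 1 / (real n + 1)" for n
    have y: "y n > 0" "y n \<le> 1" for n by (auto simp: y_def)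
    have "y \<longlonglongrightarrow> 0" unfolding y_def by real_asymp
    from tendsto_norm_zero[OF Herglotz_fun_atom_limit[OF \<mu>(2) zero y this, of a b]]
    have "(\<lambda>n. cmod (of_real (y n) * Herglotz_fun a b \<mu> (of_real x + \<i> * of_real (y n)))) \<longlonglongrightarrow> 0" .
    moreover have "exp (- J / 2) \<le> cmod (of_real (y n) * Herglotz_fun a b \<mu> (of_real x + \<i> * of_real (y n)))" for n
    proof -
      have "- ln (y n) - J / 2 \<le> Re (h (of_real x + \<i> * of_real (y n)))"
        unfolding h_def \<phi>_def J_def by (rule Cauchy_transform_Re_ge[OF K(3,2) rest y(1)])
      then have "exp (- J / 2) \<le> exp (ln (y n) + Re (h (of_real x + \<i> * of_real (y n))))" by simp
      also have "\<dots> = y n * cmod (F (of_real x + \<i> * of_real (y n)))"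
        using y(1)[of n] by (simp add: exp_add F_def norm_mult)
      finally show ?thesis using y(1)[of n] by (simp add: rep norm_mult)
    qed
    ultimately have "exp (- J / 2) \<le> 0" by (intro LIMSEQ_le_const) auto
    then show False by simp
  qed
  ultimately show ?thesis by blast
qed

theorem theorem1p2:
  fixes E :: "real set" and x :: real
  assumes "E \<in> sets borel"
  shows "(\<forall>\<mu> \<in> reflectionless_measures E. emeasure \<mu> {x} = 0) \<longleftrightarrow>
         (\<integral>\<^sup>+ t \<in> {x - 1..x + 1}. ennreal (indicator E t / \<bar>t - x\<bar>) \<partial>lborel) = \<infinity>"
    (is "?no_atom \<longleftrightarrow> ?I = \<infinity>")
proof
  assume ?no_atom
  then show "?I = \<infinity>"
    using finite_imp_reflectionless_atom[OF assms, of x] by (auto simp: less_top[symmetric])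
next
  assume "?I = \<infinity>"
  then show ?no_atom
    using reflectionless_atom_imp_finite[OF assms, of _ x] by force
qed

end
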